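(* Let $\mu$ be a non-degenerate probability measure on $\Gamma=\mathbb Z_2*\mathbb Z_3$ whose support is contained in $S=\{a,b,\bar b,ba,\bar b a\}$. Then the harmonic measure $\nu$ of the random walk $(\Gamma,\mu)$ belongs to one of the Denjoy measure classes $\boldsymbol\kappa^\alpha$. Moreover, $$\nu=\kappa^{\alpha,p}\qquad\text{with}\quad \alpha=\pi_{ba}\quad\text{and}\quad p=\frac{\pi_a}{1+\pi_a},$$ where $\pi_g$ denotes the passage probability of $g\in\Gamma$.
   Context: $\Gamma=\mathbb Z_2*\mathbb Z_3$ with $\mathbb Z_2=\langle a\mid a^2\rangle$, $\mathbb Z_3=\langle b\mid b^3\rangle$, $\bar b=b^{-1}=b^2$. Elements of $\Gamma$ are identified with finite words in $\{a,b,\bar b\}$ in which the letter $a$ and letters from $\{b,\bar b\}$ alternate. $\partial\Gamma$ is the set of right-infinite words in $\{a,b,\bar b\}$ subject to the same alternation rule, with the topology induced by the product topology; $\Gamma$ acts on it on the left by concatenation followed, if necessary, by reduction. A sequence $g_n\in\Gamma$ converges to $\gamma\in\partial\Gamma$ if for every $k$ the first $k$ letters of $g_n$ coincide with those of $\gamma$ for all large $n$. A probability measure $\mu$ on $\Gamma$ is non-degenerate if its support generates $\Gamma$ as a semigroup. For $\mu$ as in the claim, the sample paths $g_n=h_1\cdots h_n$ (with $g_0=e$ and $h_i$ independent and $\mu$-distributed) of the random walk $(\Gamma,\mu)$ converge almost surely to $\partial\Gamma$; the distribution of the limit is the harmonic measure of $\mu$; it is the unique probability measure $\nu$ on $\partial\Gamma$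 with $\nu=\sum_g\mu(g)\,g\nu$. The passage probability $\pi_g$ is the probability that a sample path issued from the identity $e$ ever visits $g$. For $0<\alpha<1$ let $\kappa^\alpha$ be the distribution of the random infinite word $a\beta_1a\beta_2a\cdots$, where the $\beta_i$ are independent and take the values $b$ and $\bar b$ with probabilities $\alpha$ and $1-\alpha$. For $0<p<1$ put $\kappa^{\alpha,p}=p\,\kappa^\alpha+(1-p)\,a\kappa^\alpha$, where $a\kappa^\alpha$ is the image of $\kappa^\alpha$ under the action of $a$ (the distribution of $\beta_1a\beta_2a\cdots$). The Denjoy measure class $\boldsymbol\kappa^\alpha$ is the common measure class of the measures $\kappa^{\alpha,p}$, $0<p<1$. *)

theory Defs
  imports "HOL-Probability.Probability" "HOL-Algebra.Group"
begin

text \<open>The letters \<open>La\<close>, \<open>Lb\<close>, \<open>Lbbar\<close> stand for \<open>a\<close>, \<open>b\<close> and \<open>b\<^sup>-\<^sup>1 = b\<^sup>2\<close>.\<close>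

datatype letter = La | Lb | Lbbar

definition alternates :: "letter \<Rightarrow> letter \<Rightarrow> bool" where
  "alternates x y \<longleftrightarrow> (x = La) \<noteq> (y = La)"

fun red2 :: "letter \<Rightarrow> letter \<Rightarrow> letter list" where
  "red2 La La = []"
| "red2 Lb Lb = [Lbbar]"
| "red2 Lb Lbbar = []"
| "red2 Lbbar Lb = []"
| "red2 Lbbar Lbbar = [Lb]"
| "red2 x y = [x, y]"

fun red_cons :: "letter \<Rightarrow> letter list \<Rightarrow> letter list" where
  "red_cons x [] = [x]"
| "red_cons x (y # w) = red2 x y @ w"

text \<open>The free product \<open>\<int>\<^sub>2 * \<int>\<^sub>3\<close>, realised on the reduced words: the product is
  concatenation followed by reduction, multiplying by the letters of the first word one at a time
  from the left.\<close>

definition Gam :: "letter list monoid" where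
  "Gam = \<lparr>carrier = {w. successively alternates w}, mult = foldr red_cons, one = []\<rparr>"

lemma Gam_simps [simp]:
  "w \<in> carrier Gam \<longleftrightarrow> successively alternates w"
  "\<one>\<^bsub>Gam\<^esub> = []"
  "u \<otimes>\<^bsub>Gam\<^esub> v = foldr red_cons u v"
  by (simp_all add: Gam_def)

lemma red_cons_alternating:
  "successively alternates w \<Longrightarrow> successively alternates (red_cons x w)"
proof (cases w)
  case (Cons y w')
  assume "successively alternates w"
  then show ?thesis
    using Cons by (cases x; cases y; cases w') (auto simp: alternates_def)
qed simp

lemma foldr_red_cons_alternating:
  "successively alternates w \<Longrightarrow> successively alternates (foldr red_cons u w)"
  by (induction u) (auto intro: red_cons_alternating)

lemma foldr_red_cons_red_cons:
  assumes "successively alternates v" "successively alternates w"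
  shows "foldr red_cons (red_cons x v) w = red_cons x (foldr red_cons v w)"
proof (cases v)
  case (Cons y v')
  have *: "foldr red_cons (red2 x y) u = red_cons x (red_cons y u)"
    if "successively alternates u" for u
  proof (cases u)
    case Nil then show ?thesis by (cases x; cases y) auto
  next
    case (Cons z u')
    then show ?thesis
      using that by (cases x; cases y; cases z; cases u'; auto simp: alternates_def; cases "hd u'"; auto simp: alternates_def)
  qed
  show ?thesis
    using *[OF foldr_red_cons_alternating[OF assms(2), of v']] Cons by simp
qed simp

lemma foldr_red_cons_self: "successively alternates u \<Longrightarrow> foldr red_cons u [] = u"
proof (induction u)
  case (Cons x u)
  then show ?case by (cases u; cases x; cases "hd u") (auto simp: alternates_def)
qed simp

lemma group_Gam: "group Gam"
proof (rule groupI)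
  fix x y z assume "x \<in> carrier Gam" "y \<in> carrier Gam" "z \<in> carrier Gam"
  then have "foldr red_cons (foldr red_cons x y) z = foldr red_cons x (foldr red_cons y z)"
    by (induction x)
      (auto simp: foldr_red_cons_red_cons foldr_red_cons_alternating successively_Cons)
  then show "x \<otimes>\<^bsub>Gam\<^esub> y \<otimes>\<^bsub>Gam\<^esub> z = x \<otimes>\<^bsub>Gam\<^esub> (y \<otimes>\<^bsub>Gam\<^esub> z)"
    by simp
next
  fix x assume "x \<in> carrier Gam"
  then have "successively alternates x" by simp
  then have "\<exists>y. successively alternates y \<and> foldr red_cons y x = []"
  proof (induction x)
    case (Cons c x)
    then obtain y where y: "successively alternates y" "foldr red_cons y x = []"
      by (auto simp: successively_Cons)
    define d where "d = (case c of La \<Rightarrow> La | Lb \<Rightarrow> Lbbar | Lbbar \<Rightarrow> Lb)"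
    have "foldr red_cons (foldr red_cons y [d]) (c # x) = foldr red_cons y (foldr red_cons [d] (c # x))"
      by (induction y) (use Cons.prems in \<open>auto simp: foldr_red_cons_red_cons foldr_red_cons_alternating\<close>)
    also have "foldr red_cons [d] (c # x) = x"
      by (cases c) (auto simp: d_def)
    finally show ?case
      using y by (intro exI[of _ "foldr red_cons y [d]"]) (auto intro: foldr_red_cons_alternating)
  qed (auto intro: exI[of _ "[]"])
  then show "\<exists>y\<in>carrier Gam. y \<otimes>\<^bsub>Gam\<^esub> x = \<one>\<^bsub>Gam\<^esub>"
    by auto
qed (auto intro: foldr_red_cons_alternating)

definition boundary :: "letter stream set" where
  "boundary = {\<xi>. \<forall>n. alternates (\<xi> !! n) (\<xi> !! Suc n)}"

text \<open>The alphabet is finite, so the Borel sigma-algebra of the product topology is the product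
  sigma-algebra.\<close>

definition bdry :: "letter stream measure" where
  "bdry = restrict_space (stream_space (count_space UNIV)) boundary"

definition red_scons :: "letter \<Rightarrow> letter stream \<Rightarrow> letter stream" where
  "red_scons x \<xi> = red2 x (shd \<xi>) @- stl \<xi>"

definition act :: "letter list \<Rightarrow> letter stream \<Rightarrow> letter stream" where
  "act g \<xi> = foldr red_scons g \<xi>"

definition converges_to :: "(nat \<Rightarrow> letter list) \<Rightarrow> letter stream \<Rightarrow> bool" where
  "converges_to g \<xi> \<longleftrightarrow> (\<forall>k. \<forall>\<^sub>F n in sequentially. take k (g n) = stake k \<xi>)"

inductive_set semigroup_gen :: "letter list set \<Rightarrow> letter list set" for X where
  base: "x \<in> X \<Longrightarrow> x \<in> semigroup_gen X"
| mult: "x \<in> semigroup_gen X \<Longrightarrow> y \<in> semigroup_gen X \<Longrightarrow> x \<otimes>\<^bsub>Gam\<^esub> y \<in> semigroup_gen X"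

definition nondegenerate :: "letter list pmf \<Rightarrow> bool" where
  "nondegenerate \<mu> \<longleftrightarrow> semigroup_gen (set_pmf \<mu>) = carrier Gam"

text \<open>The stream \<open>h\<close> of increments is indexed from \<open>0\<close>: \<open>h !! n\<close> is the increment from
  time \<open>n\<close> to time \<open>n + 1\<close>.\<close>

primrec walk :: "letter list stream \<Rightarrow> nat \<Rightarrow> letter list" where
  "walk h 0 = \<one>\<^bsub>Gam\<^esub>"
| "walk h (Suc n) = walk h n \<otimes>\<^bsub>Gam\<^esub> (h !! n)"

definition increments :: "letter list pmf \<Rightarrow> letter list stream measure" where
  "increments \<mu> = stream_space (measure_pmf \<mu>)"

definition passage_prob :: "letter list pmf \<Rightarrow> letter list \<Rightarrow> real" where
  "passage_prob \<mu> g = measure (increments \<mu>) {h \<in> space (increments \<mu>). \<exists>n. walk h n = g}"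

text \<open>The distribution of the limit of the sample paths. Paths which do not converge contribute
  nothing, so that the total mass is \<open>1\<close> precisely if almost all sample paths converge.\<close>

definition harmonic_measure :: "letter list pmf \<Rightarrow> letter stream measure" where
  "harmonic_measure \<mu> = measure_of (space bdry) (sets bdry)
     (\<lambda>E. emeasure (increments \<mu>) {h \<in> space (increments \<mu>). \<exists>\<xi>\<in>E. converges_to (walk h) \<xi>})"

definition denjoy_word :: "bool stream \<Rightarrow> letter stream" where
  "denjoy_word \<epsilon> = sinterleave (sconst La) (smap (\<lambda>e. if e then Lb else Lbbar) \<epsilon>)"

definition kappa :: "real \<Rightarrow> letter stream measure" where
  "kappa \<alpha> = distr (stream_space (measure_pmf (bernoulli_pmf \<alpha>))) bdry denjoy_word"

definition kappa2 :: "real \<Rightarrow> real \<Rightarrow> letter stream measure" where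
  "kappa2 \<alpha> p = measure_of (space bdry) (sets bdry)
     (\<lambda>E. ennreal p * emeasure (kappa \<alpha>) E
        + ennreal (1 - p) * emeasure (distr (kappa \<alpha>) bdry (act [La])) E)"

definition measure_class :: "'a measure \<Rightarrow> 'a measure set" where
  "measure_class M = {N. sigma_finite_measure N \<and> sets N = sets M \<and> null_sets N = null_sets M}"

text \<open>For fixed \<open>\<alpha>\<close> the classes of the measures \<open>kappa2 \<alpha> p\<close> all coincide, and the
  intersection is this common class.\<close>

definition denjoy_class :: "real \<Rightarrow> letter stream measure set" where
  "denjoy_class \<alpha> = (\<Inter>p\<in>{0<..<1}. measure_class (kappa2 \<alpha> p))"

end

theory Submission
  imports Defs
begin

text \<open>
  A step in \<open>{a, b, b\<^sup>-\<^sup>1, ba, b\<^sup>-\<^sup>1a}\<close> can carry a path into the cone of words beginning with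
  \<open>x = a, ba, b\<^sup>-\<^sup>1a\<close> only at the apex \<open>x\<close> itself. By the strong Markov property at the first
  visit to \<open>x\<close>, the limit word restricted to this cone is therefore \<open>\<pi>\<^sub>x\<close> times the law of
  \<open>x\<close> followed by a limit word not beginning with \<open>a\<close>. These self-similarity relations determine the
  harmonic measure on cylinders, force \<open>\<pi>\<^bsub>ba\<^esub> + \<pi>\<^bsub>b\<^sup>-\<^sup>1a\<^esub> = 1\<close>, and are also satisfied by the Denjoy measures.

  Convergence of the paths reduces to transience, since a step changes only the last two letters.
  Transience follows from \<open>\<pi>\<^sub>a < 1\<close>, which is proved with an explicit harmonic function
  on the words outside the cone of \<open>a\<close>: if the path returned to the identity infinitely often with
  positive probability \<open>Q\<close>, this probability would be the same from every starting point, while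
  from \<open>a\<close> it equals \<open>\<pi>\<^sub>a Q\<close>.
\<close>

section \<open>Words, paths and limits\<close>

instance letter :: countable by countable_datatype

abbreviation gmul :: "letter list \<Rightarrow> letter list \<Rightarrow> letter list" (infixl "\<odot>" 70) where
  "u \<odot> v \<equiv> foldr red_cons u v"

abbreviation alternating :: "letter list \<Rightarrow> bool" where
  "alternating w \<equiv> successively alternates w"

abbreviation steps :: "letter list set" where
  "steps \<equiv> {[La], [Lb], [Lbbar], [Lb, La], [Lbbar, La]}"

abbreviation gates :: "letter list set" where
  "gates \<equiv> {[La], [Lb, La], [Lbbar, La]}"

lemma steps_alternating: "s \<in> steps \<Longrightarrow> alternating s"
  by (auto simp: alternates_def)

lemma gates_alternating: "x \<in> gates \<Longrightarrow> alternating x"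
  by (auto simp: alternates_def)

section \<open>Multiplying a reduced word by one step\<close>

lemma gmul_assoc:
  "alternating u \<Longrightarrow> alternating v \<Longrightarrow> alternating w \<Longrightarrow> u \<odot> v \<odot> w = u \<odot> (v \<odot> w)"
  using monoid.m_assoc[OF group.is_monoid[OF group_Gam], of u v w] by simp

lemma gmul_left_cancel:
  assumes "alternating x" "alternating u" "alternating v" "x \<odot> u = x \<odot> v"
  shows "u = v"
  using monoid.Units_l_cancel[OF group.is_monoid[OF group_Gam], of x u v] assms
  by (simp add: group.Units_eq[OF group_Gam])

lemma gmul_eq_append: "alternating (u @ v) \<Longrightarrow> u \<odot> v = u @ v"
proof (induction u)
  case (Cons x u)
  then show ?case
    by (cases "u @ v"; cases x; cases "hd (u @ v)") (auto simp: alternates_def successively_Cons)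
qed simp

text \<open>A step reaches at most two letters back: the product of the last two letters with
  \<open>s\<close> is either empty (as for \<open>ab\<close> times \<open>b^-1 a\<close>) or still
  begins with \<open>y\<close>, so no reduction crosses into \<open>p\<close>.\<close>

lemma gmul_step_last_two:
  assumes "alternating (p @ [y, z])" "s \<in> steps"
  shows "(p @ [y, z]) \<odot> s = p @ ([y, z] \<odot> s)"
proof -
  have yz: "alternating [y, z]" and s: "alternating s"
    using assms by (auto simp: successively_append_iff alternates_def)
  have "[y, z] \<odot> s = [] \<or> hd ([y, z] \<odot> s) = y"
    using assms(2) yz by (cases y; cases z) (auto simp: alternates_def)
  moreover have "alternating ([y, z] \<odot> s)"
    using foldr_red_cons_alternating[OF s] .
  ultimately have "alternating (p @ ([y, z] \<odot> s))"
    using assms(1) by (auto simp: successively_append_iff)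
  then show ?thesis
    using gmul_eq_append by simp
qed

lemma take_gmul_step:
  assumes "alternating g" "s \<in> steps" "k + 2 \<le> length g"
  shows "take k (g \<odot> s) = take k g"
proof -
  obtain y z where "drop (length g - 2) g = [y, z]"
    using assms(3)
    by (cases "drop (length g - 2) g"; cases "tl (drop (length g - 2) g)") 
       (auto dest!: arg_cong[where f=length])
  then have g: "g = take (length g - 2) g @ [y, z]"
    by (metis append_take_drop_id)
  then have "g \<odot> s = take (length g - 2) g @ ([y, z] \<odot> s)"
    using gmul_step_last_two[of "take (length g - 2) g" y z s] assms(1,2) by metis
  then show ?thesis
    using assms(3) by (simp add: min_absorb1)
qed

text \<open>Gates have at most two letters, so by \<open>take_gmul_step\<close> a word with four or
  more letters keeps the relevant prefix; the shorter words are finitely many and are checked one by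
  one.\<close>

lemma enter_cone_at_gate:
  assumes "x \<in> gates" "alternating g" "s \<in> steps"
    and "take (length x) g \<noteq> x" "take (length x) (g \<odot> s) = x"
  shows "g \<odot> s = x"
proof (cases "length g \<ge> 4")
  case True
  then have "take (length x) (g \<odot> s) = take (length x) g"
    using assms by (intro take_gmul_step) auto
  with assms show ?thesis by simp
next
  case False
  then consider "g = []" | c where "g = [c]" | c d where "g = [c, d]" | c d e where "g = [c, d, e]"
    by (cases g; cases "tl g"; cases "tl (tl g)"; cases "tl (tl (tl g))") auto
  then show ?thesis
  proof cases
    case 1 then show ?thesis using assms by auto
  next
    case 2 then show ?thesis using assms by (cases c) auto
  next
    case 3 then show ?thesis using assms by (cases c; cases d) (auto simp: alternates_def)
  next
    case 4 then show ?thesis using assms by (cases c; cases d; cases e) (auto simp: alternates_def)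
  qed
qed

section \<open>Paths from an arbitrary starting word\<close>

primrec pos :: "letter list \<Rightarrow> letter list stream \<Rightarrow> nat \<Rightarrow> letter list" where
  "pos g h 0 = g"
| "pos g h (Suc n) = pos (g \<odot> shd h) (stl h) n"

lemma pos_Suc_right: "pos g h (Suc n) = pos g h n \<odot> (h !! n)"
  by (induction n arbitrary: g h) auto

text \<open>\<open>pos\<close> peels off the first increment, which suits conditioning on the first
  step and varying the start, whereas \<open>walk\<close> appends the last one.\<close>

lemma walk_eq_pos: "walk h = pos [] h"
proof
  show "walk h n = pos [] h n" for n
    by (induction n) (simp_all add: pos_Suc_right del: pos.simps(2))
qed

lemma pos_add: "pos g h (n + m) = pos (pos g h n) (sdrop n h) m"
  by (induction n arbitrary: g h) auto

lemma pos_alternating: 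
  assumes "h \<in> streams steps" "alternating g" shows "alternating (pos g h n)"
proof (induction n)
  case (Suc n)
  have "h !! n \<in> steps" using assms(1) by (meson snth_in)
  then show ?case
    unfolding pos_Suc_right by (intro foldr_red_cons_alternating steps_alternating)
qed (simp add: assms)

lemma pos_gmul:
  assumes "h \<in> streams steps" "alternating g" "alternating x"
  shows "pos (x \<odot> g) h n = x \<odot> pos g h n"
proof (induction n)
  case (Suc n)
  have "h !! n \<in> steps" using assms(1) by (meson snth_in)
  then show ?case
    unfolding pos_Suc_right Suc
    using pos_alternating[OF assms(1,2)] steps_alternating assms by (intro gmul_assoc) auto
qed simp

lemma pos_eq_translate:
  assumes "h \<in> streams steps" "alternating y" "alternating x" "alternating g"
  shows "pos (y \<odot> g) h n = y \<odot> x \<longleftrightarrow> pos g h n = x"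
  using gmul_left_cancel[of y "pos g h n" x] pos_gmul[OF assms(1,4,2), of n]
    pos_alternating[OF assms(1,4), of n] assms by auto

section \<open>The boundary and convergence to it\<close>

lemma boundary_stl: "\<xi> \<in> boundary \<Longrightarrow> stl \<xi> \<in> boundary"
  unfolding boundary_def by (auto simp flip: snth.simps(2))

lemma boundary_Stream: "c ## \<xi> \<in> boundary \<longleftrightarrow> alternates c (shd \<xi>) \<and> \<xi> \<in> boundary"
proof
  assume "c ## \<xi> \<in> boundary"
  then show "alternates c (shd \<xi>) \<and> \<xi> \<in> boundary"
    using boundary_stl[of "c ## \<xi>"] by (auto simp: boundary_def dest: spec[where x = 0])
next
  assume *: "alternates c (shd \<xi>) \<and> \<xi> \<in> boundary"
  have "alternates ((c ## \<xi>) !! n) ((c ## \<xi>) !! Suc n)" for n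
    using * by (cases n) (auto simp: boundary_def)
  then show "c ## \<xi> \<in> boundary"
    by (auto simp: boundary_def)
qed

lemma red_scons_boundary: "\<xi> \<in> boundary \<Longrightarrow> red_scons c \<xi> \<in> boundary"
proof (cases \<xi>)
  case (SCons d \<zeta>)
  assume "\<xi> \<in> boundary"
  then show ?thesis using SCons
    by (cases c; cases d; cases "shd \<zeta>") (auto simp: red_scons_def boundary_Stream alternates_def)
qed

lemma act_boundary: "\<xi> \<in> boundary \<Longrightarrow> act g \<xi> \<in> boundary"
  unfolding act_def by (induction g) (auto intro: red_scons_boundary)

text \<open>Left multiplication by a letter rewrites only the first letter of a nonempty word, so it
  passes to limits.\<close>

lemma converges_to_red_cons:
  assumes "converges_to w \<xi>"
  shows "converges_to (\<lambda>n. red_cons c (w n)) (red_scons c \<xi>)"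
  unfolding converges_to_def
proof
  fix k
  \<comment> \<open>One extra letter has to be settled because cancellation may delete the first
    one.\<close>
  have "\<forall>\<^sub>F n in sequentially. take (Suc k) (w n) = stake (Suc k) \<xi>"
    using assms unfolding converges_to_def by blast
  then show "\<forall>\<^sub>F n in sequentially. take k (red_cons c (w n)) = stake k (red_scons c \<xi>)"
  proof eventually_elim
    case (elim n)
    then obtain w' where w: "w n = shd \<xi> # w'" and w': "take k w' = stake k (stl \<xi>)"
      by (cases "w n") auto
    have *: "take j w' = stake j (stl \<xi>)" if "j \<le> k" for j
      using arg_cong[OF w', of "take j"] that by (simp add: min_absorb1 take_stake)
    have "take k (l @ w') = stake k (l @- stl \<xi>)" for l
      by (simp add: stake_shift take_stake *)
    then show ?case
      by (simp add: w red_scons_def)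
  qed
qed

lemma converges_to_gmul: "converges_to w \<xi> \<Longrightarrow> converges_to (\<lambda>n. g \<odot> w n) (act g \<xi>)"
  unfolding act_def by (induction g) (auto intro: converges_to_red_cons)

lemma converges_to_shift: "converges_to (\<lambda>n. w (n + k)) \<xi> \<longleftrightarrow> converges_to w \<xi>"
  unfolding converges_to_def
  using eventually_sequentially_seg[of "\<lambda>n. take _ (w n) = stake _ \<xi>"] by auto

lemma converges_to_nth: 
  assumes "converges_to w \<xi>"
  shows "\<forall>\<^sub>F n in sequentially. i < length (w n) \<and> w n ! i = \<xi> !! i"
proof -
  have "\<forall>\<^sub>F n in sequentially. take (Suc i) (w n) = stake (Suc i) \<xi>"
    using assms unfolding converges_to_def by blast
  then show ?thesis
  proof eventually_elim
    case (elim n)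
    have "length (take (Suc i) (w n)) = Suc i" 
      using elim by (metis length_stake)
    moreover have "take (Suc i) (w n) ! i = \<xi> !! i"
      using elim by (metis lessI stake_nth)
    ultimately show ?case by auto
  qed
qed

text \<open>The letterwise form serves both to construct limits and to prove measurability; the
  length bound keeps \<open>!\<close> within its range.\<close>

lemma converges_to_iff_nth:
  "converges_to w \<xi> \<longleftrightarrow> (\<forall>i. \<forall>\<^sub>F n in sequentially. i < length (w n) \<and> w n ! i = \<xi> !! i)"
proof
  assume *: "\<forall>i. \<forall>\<^sub>F n in sequentially. i < length (w n) \<and> w n ! i = \<xi> !! i"
  show "converges_to w \<xi>"
    unfolding converges_to_def
  proof
    fix k
    have "\<forall>\<^sub>F n in sequentially. \<forall>i\<in>{..<k}. i < length (w n) \<and> w n ! i = \<xi> !! i"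
      using * by (intro eventually_ball_finite) auto
    moreover have "\<forall>\<^sub>F n in sequentially. k < length (w n)"
      using *[rule_format, of k] by eventually_elim simp
    ultimately show "\<forall>\<^sub>F n in sequentially. take k (w n) = stake k \<xi>"
      by eventually_elim (auto intro!: nth_equalityI)
  qed
qed (use converges_to_nth in blast)

lemma converges_to_boundary:
  assumes "converges_to w \<xi>" "\<And>n. alternating (w n)"
  shows "\<xi> \<in> boundary"
proof -
  have "alternates (\<xi> !! i) (\<xi> !! Suc i)" for i
  proof -
    have "\<forall>\<^sub>F n in sequentially. (i < length (w n) \<and> w n ! i = \<xi> !! i) \<and>
        (Suc i < length (w n) \<and> w n ! Suc i = \<xi> !! Suc i)"
      by (intro eventually_conj converges_to_nth assms)
    then obtain n where "w n ! i = \<xi> !! i" "Suc i < length (w n)" "w n ! Suc i = \<xi> !! Suc i"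
      by (auto simp: eventually_sequentially)
    then show ?thesis
      using assms(2)[of n] by (metis successively_nth)
  qed
  then show ?thesis by (auto simp: boundary_def)
qed

text \<open>Collects the almost sure properties from which convergence and the gate arguments follow
  path by path.\<close>

definition transient_path :: "letter list stream \<Rightarrow> bool" where
  "transient_path h \<longleftrightarrow> h \<in> streams steps \<and> (\<forall>g. finite {n. pos [] h n = g})"

text \<open>Only finitely many words have bounded length, so visiting each word finitely often
  forces the lengths to infinity. A letter is frozen once it stays outside the last two, since a
  step changes only those.\<close>

lemma transient_path_converges:
  assumes "transient_path h"
  shows "\<exists>\<xi>\<in>boundary. converges_to (pos [] h) \<xi>"
proof -
  have h: "h \<in> streams steps" and fin: "\<And>g. finite {n. pos [] h n = g}"
    using assms by (auto simp: transient_path_def)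
  have alt: "alternating (pos [] h n)" for n
    using pos_alternating[OF h] by simp
  have ev: "\<forall>\<^sub>F n in sequentially. k < length (pos [] h n)" for k
  proof -
    have "finite {l :: letter list. set l \<subseteq> {La, Lb, Lbbar} \<and> length l \<le> k}"
      by (intro finite_lists_length_le) auto
    moreover have "set l \<subseteq> {La, Lb, Lbbar}" for l
      by (auto intro: letter.exhaust)
    ultimately have "finite {l :: letter list. length l \<le> k}"
      by simp
    then have "finite (\<Union>l\<in>{l. length l \<le> k}. {n. pos [] h n = l})"
      using fin by blast
    moreover have "{n. length (pos [] h n) \<le> k} = (\<Union>l\<in>{l. length l \<le> k}. {n. pos [] h n = l})"
      by auto
    ultimately have "finite {n. \<not> k < length (pos [] h n)}"
      by (simp add: not_less)
    then show ?thesis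
      by (simp add: cofinite_eq_sequentially[symmetric] eventually_cofinite)
  qed
  have "\<exists>c. \<forall>\<^sub>F n in sequentially. i < length (pos [] h n) \<and> pos [] h n ! i = c" for i
  proof -
    \<comment> \<open>\<open>Suc i\<close> letters up to position \<open>i\<close>, and two more
      that a step may alter.\<close>
    obtain N where N: "\<And>n. n \<ge> N \<Longrightarrow> Suc i + 2 < length (pos [] h n)"
      using ev[of "Suc i + 2"] by (auto simp: eventually_sequentially)
    have "take (Suc i) (pos [] h n) = take (Suc i) (pos [] h N)" if "n \<ge> N" for n
      using that
    proof (induction n rule: dec_induct)
      case (step n)
      have "h !! n \<in> steps" using h by (meson snth_in)
      then have "take (Suc i) (pos [] h (Suc n)) = take (Suc i) (pos [] h n)"
        unfolding pos_Suc_right using step N[of n] by (intro take_gmul_step alt) auto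
      then show ?case using step by simp
    qed simp
    then have "pos [] h n ! i = pos [] h N ! i" if "n \<ge> N" for n
      using that by (metis lessI nth_take)
    moreover have "i < length (pos [] h n)" if "n \<ge> N" for n
      using N[OF that] by simp
    ultimately show ?thesis
      unfolding eventually_sequentially by blast
  qed
  then obtain c where "\<forall>\<^sub>F n in sequentially. i < length (pos [] h n) \<and> pos [] h n ! i = c i" for i
    by metis
  then have "converges_to (pos [] h) (to_stream c)"
    unfolding converges_to_iff_nth by (simp add: to_stream_def)
  then show ?thesis
    using converges_to_boundary alt by blast
qed

lemma transient_path_sdrop:
  assumes "transient_path h"
  shows "transient_path (sdrop n h)"
proof -
  have h: "h \<in> streams steps" and fin: "\<And>g. finite {n. pos [] h n = g}"
    using assms by (auto simp: transient_path_def)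
  have h': "sdrop n h \<in> streams steps"
    using h by (simp add: streams_iff_snth sdrop_snth)
  have "finite {m. pos [] (sdrop n h) m = g}" for g
  proof (rule finite_imageD)
    have "pos [] h (n + m) = pos [] h n \<odot> pos [] (sdrop n h) m" for m
      using pos_gmul[OF h', of "[]" "pos [] h n" m] pos_alternating[OF h, of "[]" n]
      by (simp add: pos_add foldr_red_cons_self)
    then show "finite ((+) n ` {m. pos [] (sdrop n h) m = g})"
      by (intro finite_subset[OF _ fin[of "pos [] h n \<odot> g"]]) auto
  qed simp
  with h' show ?thesis
    by (auto simp: transient_path_def)
qed

text \<open>The path starts outside the cone of \<open>x\<close> and its limit lies inside. At the
  first time \<open>N\<close> with prefix \<open>x\<close>, \<open>enter_cone_at_gate\<close> shows
  that the path is at \<open>x\<close> itself.\<close>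

lemma hits_gate:
  assumes "h \<in> streams steps" "converges_to (pos [] h) \<xi>" "x \<in> gates" "stake (length x) \<xi> = x"
  shows "\<exists>n. pos [] h n = x"
proof -
  define N where "N = (LEAST n. take (length x) (pos [] h n) = x)"
  have "\<exists>n. take (length x) (pos [] h n) = x"
    using assms(2,4) unfolding converges_to_def eventually_sequentially by (metis order_refl)
  then have N: "take (length x) (pos [] h N) = x"
    unfolding N_def by (metis (mono_tags) LeastI_ex)
  have min: "take (length x) (pos [] h n) \<noteq> x" if "n < N" for n
    using that not_less_Least unfolding N_def by blast
  obtain n where n: "N = Suc n"
    using N assms(3) by (cases N) auto
  have "h !! n \<in> steps" using assms(1) by (meson snth_in)
  then have "pos [] h n \<odot> (h !! n) = x"
    using N n min[of n] pos_alternating[OF assms(1)] assms(3)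
    by (intro enter_cone_at_gate) (auto simp: pos_Suc_right simp del: pos.simps(2))
  then show ?thesis
    using pos_Suc_right[of "[]" h n] by metis
qed

text \<open>A gate ends in \<open>a\<close>: an initial \<open>a\<close> of \<xi> cancels it and the
  translate leaves the cone, while otherwise nothing cancels.\<close>

lemma act_gate:
  assumes "x \<in> gates" "\<xi> \<in> boundary"
  shows "stake (length x) (act x \<xi>) = x \<longleftrightarrow> shd \<xi> \<noteq> La"
    and "shd \<xi> \<noteq> La \<Longrightarrow> act x \<xi> = x @- \<xi>"
proof -
  \<comment> \<open>Cancellation consumes at most two letters of \<xi> (as for \<open>ba\<close>
    against \<open>a b^-1\<close>); the third then becomes the first letter of the result.\<close>
  obtain c d e \<zeta> where \<xi>: "\<xi> = c ## d ## e ## \<zeta>"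
    by (metis stream.exhaust)
  show "stake (length x) (act x \<xi>) = x \<longleftrightarrow> shd \<xi> \<noteq> La"
    using assms unfolding \<xi>
    by (cases c; cases d; cases e) (auto simp: act_def red_scons_def boundary_Stream alternates_def)
  show "act x \<xi> = x @- \<xi>" if "shd \<xi> \<noteq> La"
    using assms that unfolding \<xi>
    by (cases c; cases d; cases e) (auto simp: act_def red_scons_def boundary_Stream alternates_def)
qed

section \<open>First hits and the strong Markov property\<close>

text \<open>The recursion follows the first increment, so that the event can be conditioned step by
  step; time 0 counts as a hit.\<close>

primrec first_hit :: "letter list \<Rightarrow> letter list \<Rightarrow> nat \<Rightarrow> letter list stream \<Rightarrow> bool" where
  "first_hit x g 0 h \<longleftrightarrow> g = x"
| "first_hit x g (Suc n) h \<longleftrightarrow> g \<noteq> x \<and> first_hit x (g \<odot> shd h) n (stl h)"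

lemma first_hit_iff: "first_hit x g n h \<longleftrightarrow> pos g h n = x \<and> (\<forall>m<n. pos g h m \<noteq> x)"
proof (induction n arbitrary: g h)
  case (Suc n)
  show ?case
    unfolding first_hit.simps Suc by (auto simp: less_Suc_eq_0_disj)
qed simp

lemma ex_first_hit: "(\<exists>n. first_hit x g n h) \<longleftrightarrow> (\<exists>n. pos g h n = x)"
  unfolding first_hit_iff using exists_least_iff[of "\<lambda>n. pos g h n = x"] by auto

lemma first_hit_unique: "first_hit x g n h \<Longrightarrow> first_hit x g m h \<Longrightarrow> n = m"
  unfolding first_hit_iff by (metis linorder_neqE_nat)

locale walk_on_steps =
  fixes \<mu> :: "letter list pmf"
  assumes support: "set_pmf \<mu> \<subseteq> steps"
begin

abbreviation "S \<equiv> stream_space (measure_pmf \<mu>)"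

sublocale S: prob_space S
  by (rule prob_space.prob_space_stream_space) (rule prob_space_measure_pmf)

lemma space_S [simp]: "space S = UNIV"
  by (simp add: space_stream_space)

lemma sets_S [measurable_cong]: "sets S = sets (stream_space (count_space UNIV))"
  by (intro sets_stream_space_cong) simp

lemma measurable_pos [measurable]: "(\<lambda>h. pos g h n) \<in> measurable S (count_space UNIV)"
proof (induction n)
  case (Suc n)
  then have [measurable]: "(\<lambda>h. pos g h n) \<in> measurable S (count_space UNIV)" .
  have [measurable]: "(\<lambda>h. h !! n) \<in> measurable S (count_space UNIV)"
    by measurable
  show ?case
    unfolding pos_Suc_right by measurable
qed simp

lemma measurable_first_hit [measurable]: "Measurable.pred S (first_hit x g n)"
  unfolding first_hit_iff[abs_def] by measurable

lemma AE_streams: "AE h in S. h \<in> streams steps"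
proof -
  have "AE h in S. stream_all (\<lambda>s. s \<in> steps) h"
    using support by (intro prob_space.AE_stream_all prob_space_measure_pmf) (auto simp: AE_measure_pmf_iff)
  then show ?thesis
    by eventually_elim (auto simp: streams_iff_sset stream.pred_set)
qed

lemma prob_eq_AE:
  assumes "AE h in S. P h \<longleftrightarrow> Q h" "Measurable.pred S P" "Measurable.pred S Q"
  shows "measure S {h. P h} = measure S {h. Q h}"
  using assms by (intro S.finite_measure_eq_AE) (simp_all add: pred_def)

lemma emeasure_one_step:
  assumes [measurable]: "Measurable.pred S P"
  shows "emeasure S {h. P h} = (\<integral>\<^sup>+s. emeasure S {h. P (s ## h)} \<partial>measure_pmf \<mu>)"
  using prob_space.emeasure_stream_space[OF prob_space_measure_pmf, of "{h. P h}" \<mu>] assms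
  by (simp add: pred_def)

lemma measure_one_step:
  assumes "Measurable.pred S P"
  shows "measure S {h. P h} = measure_pmf.expectation \<mu> (\<lambda>s. measure S {h. P (s ## h)})"
proof -
  have "ennreal (measure S {h. P h}) = (\<integral>\<^sup>+s. ennreal (measure S {h. P (s ## h)}) \<partial>\<mu>)"
    using emeasure_one_step[OF assms] by (simp add: S.emeasure_eq_measure)
  also have "\<dots> = ennreal (measure_pmf.expectation \<mu> (\<lambda>s. measure S {h. P (s ## h)}))"
    by (intro nn_integral_eq_integral measure_pmf.integrable_const_bound[where B = 1]) auto
  finally show ?thesis
    by (subst (asm) ennreal_inj) (auto intro!: integral_nonneg)
qed

text \<open>The first \<open>n\<close> increments decide \<open>first_hit x g n\<close>, the later
  ones decide \<open>A\<close>. Their independence is obtained by induction on \<open>n\<close>,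
  conditioning on the first increment.\<close>

lemma emeasure_first_hit:
  assumes [measurable]: "Measurable.pred S A"
  shows "emeasure S {h. first_hit x g n h \<and> A (sdrop n h)} =
    emeasure S {h. first_hit x g n h} * emeasure S {h. A h}"
proof (induction n arbitrary: g)
  case 0
  show ?case 
    using S.emeasure_space_1 by (cases "g = x") simp_all
next
  case (Suc n)
  show ?case
  proof (cases "g = x")
    case False
    have "emeasure S {h. first_hit x g (Suc n) h \<and> A (sdrop (Suc n) h)} =
        (\<integral>\<^sup>+s. emeasure S {h. first_hit x g (Suc n) (s ## h) \<and> A (sdrop (Suc n) (s ## h))} \<partial>\<mu>)"
      by (rule emeasure_one_step) measurable
    also have "\<dots> = (\<integral>\<^sup>+s. emeasure S {h. first_hit x (g \<odot> s) n h} * emeasure S {h. A h} \<partial>\<mu>)"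
      using False by (simp add: Suc)
    also have "\<dots> = (\<integral>\<^sup>+s. emeasure S {h. first_hit x g (Suc n) (s ## h)} \<partial>\<mu>) * emeasure S {h. A h}"
      using False by (subst nn_integral_multc) auto
    also have "(\<integral>\<^sup>+s. emeasure S {h. first_hit x g (Suc n) (s ## h)} \<partial>\<mu>) = 
        emeasure S {h. first_hit x g (Suc n) h}"
      by (rule emeasure_one_step[symmetric]) measurable
    finally show ?thesis .
  qed simp
qed

text \<open>The target comes first, the start second; time 0 counts, so the value is 1 if they
  agree.\<close>

definition hit_prob :: "letter list \<Rightarrow> letter list \<Rightarrow> real" where
  "hit_prob x g = measure S {h. \<exists>n. pos g h n = x}"

text \<open>The first hitting time is unique, so the event splits disjointly over its values; each
  piece factors by \<open>emeasure_first_hit\<close>, and the common factor comes out of the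
  sum.\<close>

lemma strong_Markov:
  assumes [measurable]: "Measurable.pred S A"
  shows "measure S {h. \<exists>n. first_hit x g n h \<and> A (sdrop n h)} = hit_prob x g * measure S {h. A h}"
proof -
  \<comment> \<open>Used twice: for \<open>A\<close>, and for the sure event, whose sum is the
    hitting probability.\<close>
  have sums: "emeasure S {h. \<exists>n. first_hit x g n h \<and> B (sdrop n h)} =
      (\<Sum>n. emeasure S {h. first_hit x g n h \<and> B (sdrop n h)})"
    if [measurable]: "Measurable.pred S B" for B
  proof -
    have "{h. \<exists>n. first_hit x g n h \<and> B (sdrop n h)} = (\<Union>n. {h. first_hit x g n h \<and> B (sdrop n h)})"
      by auto
    moreover have "disjoint_family (\<lambda>n. {h. first_hit x g n h \<and> B (sdrop n h)})"
      unfolding disjoint_family_on_def by (auto dest: first_hit_unique)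
    moreover have "{h. first_hit x g n h \<and> B (sdrop n h)} \<in> sets S" for n
    proof -
      have "{h \<in> space S. first_hit x g n h \<and> B (sdrop n h)} \<in> sets S"
        by measurable
      then show ?thesis by simp
    qed
    ultimately show ?thesis
      by (simp add: suminf_emeasure image_subset_iff)
  qed
  have "emeasure S {h. \<exists>n. first_hit x g n h \<and> A (sdrop n h)} = 
      (\<Sum>n. emeasure S {h. first_hit x g n h}) * emeasure S {h. A h}"
    by (simp add: sums emeasure_first_hit)
  also have "(\<Sum>n. emeasure S {h. first_hit x g n h}) = emeasure S {h. \<exists>n. pos g h n = x}"
    using sums[of "\<lambda>_. True"] by (simp add: ex_first_hit)
  finally show ?thesis
    by (simp add: S.emeasure_eq_measure hit_prob_def flip: ennreal_mult)
qed

lemma hit_prob_translate: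
  assumes "alternating y" "alternating x" "alternating g"
  shows "hit_prob (y \<odot> x) (y \<odot> g) = hit_prob x g"
proof -
  have "AE h in S. (\<exists>n. pos (y \<odot> g) h n = y \<odot> x) \<longleftrightarrow> (\<exists>n. pos g h n = x)"
    using AE_streams by eventually_elim (simp add: pos_eq_translate assms)
  then show ?thesis
    unfolding hit_prob_def by (intro prob_eq_AE) measurable
qed

section \<open>Infinitely many visits\<close>

definition io_prob :: "letter list \<Rightarrow> letter list \<Rightarrow> real" where
  "io_prob x g = measure S {h. \<exists>\<^sub>\<infinity>n. pos g h n = x}"

lemma measurable_io [measurable]: "Measurable.pred S (\<lambda>h. \<exists>\<^sub>\<infinity>n. pos g h n = x)"
  unfolding INFM_nat by measurable

lemma io_prob_translate:
  assumes "alternating y" "alternating x" "alternating g"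
  shows "io_prob (y \<odot> x) (y \<odot> g) = io_prob x g"
proof -
  have "AE h in S. (\<exists>\<^sub>\<infinity>n. pos (y \<odot> g) h n = y \<odot> x) \<longleftrightarrow> (\<exists>\<^sub>\<infinity>n. pos g h n = x)"
    using AE_streams by eventually_elim (simp add: pos_eq_translate assms)
  then show ?thesis
    unfolding io_prob_def by (intro prob_eq_AE) measurable
qed

text \<open>Infinitely many visits require a first one, and dropping the path before it does not
  change whether the visits go on forever; the strong Markov property applies.\<close>

lemma io_prob_eq: "io_prob x g = hit_prob x g * io_prob x x"
proof -
  have "(\<exists>\<^sub>\<infinity>n. pos g h n = x) \<longleftrightarrow> (\<exists>n. first_hit x g n h \<and> (\<exists>\<^sub>\<infinity>m. pos x (sdrop n h) m = x))" for h
  proof -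
    have shift: "(\<exists>\<^sub>\<infinity>m. pos g h (n + m) = x) \<longleftrightarrow> (\<exists>\<^sub>\<infinity>m. pos g h m = x)" for n
      unfolding frequently_cofinite cofinite_eq_sequentially frequently_def
      using eventually_sequentially_seg[of "\<lambda>m. pos g h m \<noteq> x" n] by (simp add: add.commute)
    have *: "first_hit x g n h \<Longrightarrow> 
        (\<exists>\<^sub>\<infinity>m. pos x (sdrop n h) m = x) \<longleftrightarrow> (\<exists>\<^sub>\<infinity>m. pos g h m = x)" for n
      using shift[of n] by (simp add: pos_add first_hit_iff)
    moreover have "\<exists>n. first_hit x g n h" if "\<exists>\<^sub>\<infinity>n. pos g h n = x"
      using that by (auto simp: ex_first_hit dest: INFM_EX)
    ultimately show ?thesis by blast
  qed
  then show ?thesis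
    using strong_Markov[of "\<lambda>h. \<exists>\<^sub>\<infinity>m. pos x h m = x" x g] by (simp add: io_prob_def)
qed

text \<open>Discarding time 0 does not affect infinitely many visits, so the mean value property
  holds at every word, including the target \<open>x\<close>.\<close>

lemma io_prob_harmonic: "io_prob x g = measure_pmf.expectation \<mu> (\<lambda>s. io_prob x (g \<odot> s))"
proof -
  have "(\<exists>\<^sub>\<infinity>n. pos g (s ## h) n = x) \<longleftrightarrow> (\<exists>\<^sub>\<infinity>n. pos (g \<odot> s) h n = x)" for s h
    unfolding frequently_cofinite cofinite_eq_sequentially frequently_def
    using eventually_sequentially_Suc[of "\<lambda>m. pos g (s ## h) m \<noteq> x"] by simp
  then show ?thesis
    using measure_one_step[of "\<lambda>h. \<exists>\<^sub>\<infinity>n. pos g h n = x"] by (simp add: io_prob_def)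
qed

end

section \<open>Transience\<close>

text \<open>For suitable \<open>x\<close> and \<open>u\<close> this is the probability of ever hitting \<open>a\<close> from a word outside
  its cone: \<open>u\<close>, \<open>x\<close> and \<open>1 - x\<close> are those of passing from \<open>w\<close>, \<open>wb\<close> and \<open>wb\<^sup>-\<^sup>1\<close> to the
  product \<open>wa\<close>. The two equations of \<open>gate_weights_exist\<close> express harmonicity at \<open>e\<close> and \<open>b\<close>;
  harmonicity at \<open>b\<^sup>-\<^sup>1\<close> is then automatic because the step probabilities add up to \<open>1\<close>.\<close>

fun gate_weight :: "real \<Rightarrow> real \<Rightarrow> letter list \<Rightarrow> real" where
  "gate_weight x u [] = u"
| "gate_weight x u (La # w) = 1"
| "gate_weight x u [Lb] = x"
| "gate_weight x u [Lbbar] = 1 - x"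
| "gate_weight x u (Lb # c # w) = x * gate_weight x u w"
| "gate_weight x u (Lbbar # c # w) = (1 - x) * gate_weight x u w"

lemma gate_weight_nonneg: "0 \<le> x \<Longrightarrow> x \<le> 1 \<Longrightarrow> 0 \<le> u \<Longrightarrow> 0 \<le> gate_weight x u w"
  by (induction x u w rule: gate_weight.induct) auto

lemma not_in_cone_step:
  assumes "alternating w" "w = [] \<or> hd w \<noteq> La" "s \<in> steps"
  shows "w \<odot> s = [La] \<or> w \<odot> s = [] \<or> hd (w \<odot> s) \<noteq> La"
  using enter_cone_at_gate[of "[La]" w s] assms by (cases "w \<odot> s"; cases w) auto

text \<open>The prefix \<open>ba\<close> or \<open>b^-1 a\<close> interacts with
  \<open>w \<odot> s\<close> only if this product is \<open>a\<close>. The result is then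
  \<open>b\<close> or \<open>b^-1\<close>, whose weight is the same factor times the weight 1 of
  \<open>a\<close>.\<close>

lemma gate_weight_gmul_step:
  assumes "alternating w" "w = [] \<or> hd w \<noteq> La" "s \<in> steps"
  shows "gate_weight x u ((Lb # La # w) \<odot> s) = x * gate_weight x u (w \<odot> s)"
    and "gate_weight x u ((Lbbar # La # w) \<odot> s) = (1 - x) * gate_weight x u (w \<odot> s)"
proof -
  have *: "red_cons La (w \<odot> s) = (if w \<odot> s = [La] then [] else La # (w \<odot> s))"
    using not_in_cone_step[OF assms] by (cases "w \<odot> s"; cases "hd (w \<odot> s)") auto
  show "gate_weight x u ((Lb # La # w) \<odot> s) = x * gate_weight x u (w \<odot> s)"
    by (simp add: *)
  show "gate_weight x u ((Lbbar # La # w) \<odot> s) = (1 - x) * gate_weight x u (w \<odot> s)"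
    by (simp add: *)
qed

text \<open>For fixed \<open>u\<close> the second equation is linear in \<open>x\<close> with a
  solution in the unit interval. Substituting it into the first leaves a fixed point equation for
  \<open>u\<close>, solved by the intermediate value theorem; \<open>u = 1\<close> is then ruled
  out.\<close>

lemma gate_weights_exist:
  fixes ma mb mB mba mBa :: real
  assumes nonneg: "0 \<le> ma" "0 \<le> mb" "0 \<le> mB" "0 \<le> mba" "0 \<le> mBa"
    and sum: "ma + mb + mB + mba + mBa = 1" and "ma < 1"
  shows "\<exists>x u. 0 \<le> x \<and> x \<le> 1 \<and> 0 \<le> u \<and> u < 1 \<and>
    u = ma + mb * x + mB * (1 - x) + u * (mba * x + mBa * (1 - x)) \<and>
    x = ma * u * x + mb * (1 - x) + mB * u + mba * u * (1 - x) + mBa"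
proof -
  \<comment> \<open>\<open>D u\<close> is the coefficient of \<open>x\<close> in the second equation
    after collecting terms, \<open>X u\<close> its solution, and \<open>R u\<close> the right-hand
    side of the first equation at \<open>x = X u\<close>.\<close>
  define D where "D u = 1 - ma * u + mb + mba * u" for u
  define X where "X u = (mb + mBa + u * (mB + mba)) / D u" for u
  define R where "R u = ma + mb * X u + mB * (1 - X u) + u * (mba * X u + mBa * (1 - X u))" for u
  have D_pos: "D u > 0" if "0 \<le> u" "u \<le> 1" for u
  proof -
    have "ma * u \<le> ma * 1" using that nonneg by (intro mult_left_mono)
    moreover have "0 \<le> mba * u" using that nonneg by simp
    ultimately show ?thesis unfolding D_def using nonneg \<open>ma < 1\<close> by linarith
  qed
  have X_nonneg: "0 \<le> X u" if "0 \<le> u" "u \<le> 1" for u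
    unfolding X_def using D_pos[OF that] nonneg that by (intro divide_nonneg_pos) auto
  have X_le: "X u \<le> 1" if "0 \<le> u" "u \<le> 1" for u
  proof -
    have "u * (ma + mB) \<le> 1 * (ma + mB)" using that nonneg by (intro mult_right_mono) auto
    then have "mb + mBa + u * (mB + mba) \<le> D u"
      unfolding D_def using nonneg sum by (simp add: algebra_simps)
    then show ?thesis unfolding X_def using D_pos[OF that] by simp
  qed
  have "\<exists>u\<ge>0. u \<le> 1 \<and> u - R u = 0"
  proof (rule IVT')
    show "0 - R 0 \<le> 0"
    proof -
      have "0 \<le> mb * X 0" "0 \<le> mB * (1 - X 0)"
        using X_nonneg[of 0] X_le[of 0] nonneg by simp_all
      then show ?thesis
        unfolding R_def using nonneg by linarith
    qed
    show "0 \<le> 1 - R 1"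
    proof -
      have "mb * X 1 + mba * X 1 + mB * (1 - X 1) + mBa * (1 - X 1) 
          \<le> mb + mba + mB + mBa"
        using X_nonneg[of 1] X_le[of 1] nonneg by (intro add_mono mult_left_le) auto
      then show ?thesis unfolding R_def using sum by simp
    qed
    show "continuous_on {0..1} (\<lambda>u. u - R u)"
    proof -
      have "\<forall>u\<in>{0..1}. D u \<noteq> 0"
        using D_pos by (metis atLeastAtMost_iff less_irrefl)
      then show ?thesis
        unfolding R_def X_def D_def by (intro continuous_intros)
    qed
  qed simp
  then obtain u where u: "0 \<le> u" "u \<le> 1" "u = R u" by auto
  have eq: "X u * D u = mb + mBa + u * (mB + mba)"
    using D_pos[OF u(1,2)] by (simp add: X_def)
  have "u \<noteq> 1"
  proof
    assume "u = 1"
    define B where "B = mb + mba"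
    define B' where "B' = mB + mBa"
    have B: "0 \<le> B" "0 \<le> B'" "B + B' > 0" "ma = 1 - B - B'"
      using nonneg sum \<open>ma < 1\<close> by (auto simp: B_def B'_def)
    \<comment> \<open>This is the first equation at \<open>u = 1\<close>, by total mass 1. Both
      summands are nonnegative and hence vanish; with the second equation this gives
      \<open>B = B'\<close>, and then \<open>X 1\<close> would be both 0 and 1.\<close>
    have "B * (1 - X 1) + B' * X 1 = 0"
      using u(3) sum unfolding \<open>u = 1\<close> R_def B_def B'_def by (simp add: algebra_simps)
    then have "B * (1 - X 1) = 0" "B' * X 1 = 0"
      using B X_nonneg[of 1] X_le[of 1] by (smt (verit) mult_nonneg_nonneg)+
    moreover have "X 1 * (2 * B + B') = B + B'"
    proof -
      have "D 1 = 2 * B + B'"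
        using sum by (simp add: D_def B_def B'_def)
      then show ?thesis
        using eq unfolding \<open>u = 1\<close> by (simp add: B_def B'_def)
    qed
    ultimately show False
      using B by (auto simp: algebra_simps)
  qed
  moreover have "X u = ma * u * X u + mb * (1 - X u) + mB * u + mba * u * (1 - X u) + mBa"
    using eq unfolding D_def by (simp add: algebra_simps)
  ultimately show ?thesis
    using u X_nonneg[OF u(1,2)] X_le[OF u(1,2)] unfolding R_def
    by (intro exI[of _ "X u"] exI[of _ u]) auto
qed

locale nondegenerate_walk = walk_on_steps +
  assumes nondegenerate: "nondegenerate \<mu>"
begin

section \<open>Step probabilities and the bound on the passage to \<open>a\<close>\<close>

lemma expectation_steps:
  "measure_pmf.expectation \<mu> f = pmf \<mu> [La] * f [La] + pmf \<mu> [Lb] * f [Lb] + pmf \<mu> [Lbbar] * f [Lbbar]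
    + pmf \<mu> [Lb, La] * f [Lb, La] + pmf \<mu> [Lbbar, La] * f [Lbbar, La]" for f :: "_ \<Rightarrow> real"
proof -
  have "measure_pmf.expectation \<mu> f = (\<Sum>s\<in>steps. pmf \<mu> s * f s)"
    using support by (subst integral_measure_pmf[of steps]) auto
  then show ?thesis by simp
qed

lemma sum_steps:
  "pmf \<mu> [La] + pmf \<mu> [Lb] + pmf \<mu> [Lbbar] + pmf \<mu> [Lb, La] + pmf \<mu> [Lbbar, La] = 1"
  using expectation_steps[of "\<lambda>_. 1"] by simp

text \<open>If every step were \<open>a\<close>, the support would generate only \<open>e\<close>
  and \<open>a\<close>.\<close>

lemma pmf_La_less_1: "pmf \<mu> [La] < 1"
proof (rule ccontr)
  assume "\<not> pmf \<mu> [La] < 1"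
  then have "pmf \<mu> s = 0" if "s \<in> steps" "s \<noteq> [La]" for s
  proof -
    have "pmf \<mu> [Lb] = 0 \<and> pmf \<mu> [Lbbar] = 0 \<and> pmf \<mu> [Lb, La] = 0 \<and> pmf \<mu> [Lbbar, La] = 0"
      using sum_steps \<open>\<not> pmf \<mu> [La] < 1\<close> pmf_nonneg[of \<mu> "[Lb]"] pmf_nonneg[of \<mu> "[Lbbar]"]
        pmf_nonneg[of \<mu> "[Lb, La]"] pmf_nonneg[of \<mu> "[Lbbar, La]"] by linarith
    then show ?thesis using that by auto
  qed
  then have sub: "set_pmf \<mu> \<subseteq> {[La]}"
    using support by (auto simp: set_pmf_iff)
  have "g \<in> {[], [La]}" if "g \<in> semigroup_gen (set_pmf \<mu>)" for g
    using that by (induction rule: semigroup_gen.induct) (use sub in auto)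
  moreover have "[Lb] \<in> semigroup_gen (set_pmf \<mu>)"
    using nondegenerate by (simp add: nondegenerate_def)
  ultimately show False by blast
qed

text \<open>The two equations settle the words of length at most one. From longer words two letters
  are split off at a time: by \<open>gate_weight_gmul_step\<close> they contribute a constant
  factor.\<close>

lemma gate_weight_harmonic:
  fixes x u :: real
  defines "H \<equiv> gate_weight x u"
  assumes u: "u = pmf \<mu> [La] + pmf \<mu> [Lb] * x + pmf \<mu> [Lbbar] * (1 - x)
      + u * (pmf \<mu> [Lb, La] * x + pmf \<mu> [Lbbar, La] * (1 - x))"
    and x: "x = pmf \<mu> [La] * u * x + pmf \<mu> [Lb] * (1 - x) + pmf \<mu> [Lbbar] * u
      + pmf \<mu> [Lb, La] * u * (1 - x) + pmf \<mu> [Lbbar, La]"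
    and w: "alternating w" "w = [] \<or> hd w \<noteq> La"
  shows "measure_pmf.expectation \<mu> (\<lambda>s. H (w \<odot> s)) = H w"
  using w
proof (induction w rule: induct_list012)
  case 1
  show ?case using u by (simp add: H_def expectation_steps algebra_simps)
next
  case (2 c)
  show ?case
  proof (cases c)
    case Lb
    show ?thesis using x by (simp add: Lb H_def expectation_steps algebra_simps)
  next
    case Lbbar
    have "1 - x = pmf \<mu> [La] * (u * (1 - x)) + pmf \<mu> [Lb] * u + pmf \<mu> [Lbbar] * x
      + pmf \<mu> [Lb, La] + pmf \<mu> [Lbbar, La] * (u * x)"
    proof -
      \<comment> \<open>The right-hand sides of the equations for \<open>u\<close>, \<open>x\<close>
        and \<open>1 - x\<close> add up to \<open>1 + u\<close> times the total mass, so the third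
        follows from the other two.\<close>
      have "(1 + u) * (pmf \<mu> [La] + pmf \<mu> [Lb] + pmf \<mu> [Lbbar] + pmf \<mu> [Lb, La] + pmf \<mu> [Lbbar, La]) = 1 + u"
        by (simp only: sum_steps mult_1_right)
      then show ?thesis using u x by (simp add: algebra_simps)
    qed
    then show ?thesis by (simp add: Lbbar H_def expectation_steps algebra_simps)
  qed (use 2 in simp)
next
  case (3 c d w)
  have d: "d = La" and c: "c \<noteq> La" and w: "alternating w" "w = [] \<or> hd w \<noteq> La"
    using 3(3,4) by (auto simp: alternates_def successively_Cons)
  have IH: "measure_pmf.expectation \<mu> (\<lambda>s. H (w \<odot> s)) = H w"
    using 3(1) w .
  have "measure_pmf.expectation \<mu> (\<lambda>s. H ((c # La # w) \<odot> s)) = 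
      measure_pmf.expectation \<mu> (\<lambda>s. (if c = Lb then x else 1 - x) * H (w \<odot> s))"
  proof (intro integral_cong_AE AE_pmfI)
    fix s assume "s \<in> set_pmf \<mu>"
    then have "s \<in> steps" using support by blast
    then show "H ((c # La # w) \<odot> s) = (if c = Lb then x else 1 - x) * H (w \<odot> s)"
      using gate_weight_gmul_step[OF w] c unfolding H_def by (cases c) auto
  qed auto
  also have "\<dots> = H (c # La # w)"
    using IH c by (cases c) (auto simp: H_def)
  finally show ?case by (simp add: d)
qed

text \<open>\<open>H\<close> is nonnegative, equals 1 at \<open>a\<close> and is harmonic outside
  the cone of \<open>a\<close>, so it dominates the probability of reaching \<open>a\<close> within
  \<open>n\<close> steps. Letting \<open>n\<close> grow bounds the passage probability by
  \<open>u < 1\<close>.\<close>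

lemma hit_prob_La_less_1: "hit_prob [La] [] < 1"
proof -
  obtain x u where xu: "0 \<le> x" "x \<le> 1" "0 \<le> u" "u < 1"
    "u = pmf \<mu> [La] + pmf \<mu> [Lb] * x + pmf \<mu> [Lbbar] * (1 - x)
      + u * (pmf \<mu> [Lb, La] * x + pmf \<mu> [Lbbar, La] * (1 - x))"
    "x = pmf \<mu> [La] * u * x + pmf \<mu> [Lb] * (1 - x) + pmf \<mu> [Lbbar] * u
      + pmf \<mu> [Lb, La] * u * (1 - x) + pmf \<mu> [Lbbar, La]"
    using gate_weights_exist[OF pmf_nonneg pmf_nonneg pmf_nonneg pmf_nonneg pmf_nonneg sum_steps pmf_La_less_1]
    by metis
  define H where "H = gate_weight x u"
  have H_nonneg: "0 \<le> H w" for w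
    using gate_weight_nonneg xu unfolding H_def by simp
  \<comment> \<open>The starts are \<open>a\<close> and the words outside its cone; by
    \<open>not_in_cone_step\<close> a step from outside leads to such a word again.\<close>
  have bound: "measure S {h. \<exists>m\<le>n. pos g h m = [La]} \<le> H g"
    if "alternating g" "g = [La] \<or> g = [] \<or> hd g \<noteq> La" for n g
    using that
  proof (induction n arbitrary: g)
    case 0
    then show ?case using H_nonneg by (cases "g = [La]") (auto simp: H_def)
  next
    case (Suc n)
    show ?case
    proof (cases "g = [La]")
      case False
      have "(\<exists>m\<le>Suc n. pos g (s ## h) m = [La]) \<longleftrightarrow> (\<exists>m\<le>n. pos (g \<odot> s) h m = [La])" for s h
      proof -
        have "(\<exists>m\<le>Suc n. P m) \<longleftrightarrow> P 0 \<or> (\<exists>m\<le>n. P (Suc m))" for P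
          by (metis Suc_le_mono not0_implies_Suc zero_le)
        then show ?thesis using False by simp
      qed
      then have "measure S {h. \<exists>m\<le>Suc n. pos g h m = [La]} = 
          measure_pmf.expectation \<mu> (\<lambda>s. measure S {h. \<exists>m\<le>n. pos (g \<odot> s) h m = [La]})"
        using measure_one_step[of "\<lambda>h. \<exists>m\<le>Suc n. pos g h m = [La]"] by simp
      also have "\<dots> \<le> measure_pmf.expectation \<mu> (\<lambda>s. H (g \<odot> s))"
      proof (rule integral_mono_AE)
        show "integrable (measure_pmf \<mu>) (\<lambda>s. H (g \<odot> s))"
          using finite_subset[OF support] by (intro integrable_measure_pmf_finite) simp
        show "AE s in \<mu>. measure S {h. \<exists>m\<le>n. pos (g \<odot> s) h m = [La]} \<le> H (g \<odot> s)"
        proof (rule AE_pmfI)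
          fix s assume "s \<in> set_pmf \<mu>"
          then have "s \<in> steps" using support by blast
          then show "measure S {h. \<exists>m\<le>n. pos (g \<odot> s) h m = [La]} \<le> H (g \<odot> s)"
            using not_in_cone_step[of g s] Suc.prems False 
            by (intro Suc.IH foldr_red_cons_alternating steps_alternating) auto
        qed
      qed (intro measure_pmf.integrable_const_bound[where B = 1], auto)
      also have "\<dots> = H g"
        using gate_weight_harmonic[OF xu(5,6)] Suc.prems False unfolding H_def by auto
      finally show ?thesis .
    qed (simp add: H_def)
  qed
  have "hit_prob [La] [] = measure S (\<Union>n. {h. \<exists>m\<le>n. pos [] h m = [La]})"
    unfolding hit_prob_def by (intro arg_cong[where f = "measure S"]) auto
  moreover have "(\<lambda>n. measure S {h. \<exists>m\<le>n. pos [] h m = [La]}) \<longlonglongrightarrow>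
      measure S (\<Union>n. {h. \<exists>m\<le>n. pos [] h m = [La]})"
  proof (rule S.finite_Lim_measure_incseq)
    have "{h \<in> space S. \<exists>m\<le>n. pos [] h m = [La]} \<in> sets S" for n
      by measurable
    then show "range (\<lambda>n. {h. \<exists>m\<le>n. pos [] h m = [La]}) \<subseteq> sets S"
      by auto
    show "incseq (\<lambda>n. {h. \<exists>m\<le>n. pos [] h m = [La]})"
      by (auto simp: incseq_def) (meson order_trans)
  qed
  ultimately have "hit_prob [La] [] \<le> H []"
    using bound[of "[]"] by (intro LIMSEQ_le_const2) auto
  then show ?thesis using xu by (simp add: H_def)
qed

text \<open>Maximum principle: by \<open>io_prob_eq\<close> the value at \<open>[]\<close> is
  maximal, a harmonic function passes a maximal value on along every step of the support, and the
  support generates all words.\<close>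

lemma io_prob_Nil_const: "alternating g \<Longrightarrow> io_prob [] g = io_prob [] []"
proof -
  define Q where "Q = io_prob [] []"
  have le: "io_prob [] g \<le> Q" for g
    using S.prob_le_1 by (subst io_prob_eq) (auto simp: hit_prob_def Q_def io_prob_def intro!: mult_left_le_one_le)
  have step: "io_prob [] (y \<odot> s) = Q" if "io_prob [] y = Q" "s \<in> set_pmf \<mu>" for y s
  proof -
    have int: "integrable (measure_pmf \<mu>) (\<lambda>s. io_prob [] (y \<odot> s))"
      by (intro measure_pmf.integrable_const_bound[where B = 1]) (auto simp: io_prob_def)
    have "measure_pmf.expectation \<mu> (\<lambda>s. Q - io_prob [] (y \<odot> s)) = 0"
      using int that(1) io_prob_harmonic[of "[]" y] by simp
    then have "AE s in \<mu>. Q - io_prob [] (y \<odot> s) = 0"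
      using int le by (subst (asm) integral_nonneg_eq_0_iff_AE) auto
    then show ?thesis
      using that(2) by (auto simp: AE_measure_pmf_iff)
  qed
  have sub: "semigroup_gen (set_pmf \<mu>) \<subseteq> Collect alternating"
    using nondegenerate by (auto simp: nondegenerate_def)
  \<comment> \<open>Quantifying over \<open>y\<close> makes the set of \<open>g\<close> that
    preserve the value \<open>Q\<close> closed under products.\<close>
  have "\<forall>y. alternating y \<and> io_prob [] y = Q \<longrightarrow> io_prob [] (y \<odot> g) = Q" 
    if "g \<in> semigroup_gen (set_pmf \<mu>)" for g
    using that
  proof induction
    case (mult u v)
    have "alternating u" "alternating v"
      using mult.hyps sub by auto
    then show ?case
      using mult.IH by (auto simp: foldr_red_cons_alternating simp flip: gmul_assoc)
  qed (use step in auto)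
  moreover assume "alternating g"
  ultimately show ?thesis
    using nondegenerate unfolding nondegenerate_def Q_def by fastforce
qed

lemma io_prob_eq_0: "alternating g \<Longrightarrow> io_prob g [] = 0"
proof -
  assume g: "alternating g"
  \<comment> \<open>\<open>a\<close> is its own inverse, so left translation by it exchanges
    \<open>e\<close> and \<open>a\<close>.\<close>
  have "hit_prob [] [La] = hit_prob [La] []"
    using hit_prob_translate[of "[La]" "[]" "[La]"] by simp
  then have "io_prob [] [] = hit_prob [La] [] * io_prob [] []"
    using io_prob_Nil_const[of "[La]"] io_prob_eq[of "[]" "[La]"] by simp
  then have "io_prob [] [] = 0"
    using hit_prob_La_less_1 by auto
  moreover have "io_prob g g = io_prob [] []"
    using io_prob_translate[OF g, of "[]" "[]"] foldr_red_cons_self[OF g] by simp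
  ultimately show ?thesis
    by (subst io_prob_eq) simp
qed

lemma AE_transient_path: "AE h in S. transient_path h"
proof -
  have "AE h in S. finite {n. pos [] h n = g}" if "alternating g" for g
  proof -
    have "{h \<in> space S. \<exists>\<^sub>\<infinity>n. pos [] h n = g} \<in> sets S"
      by measurable
    then have "AE h in S. \<not> (\<exists>\<^sub>\<infinity>n. pos [] h n = g)"
      using io_prob_eq_0[OF that] by (intro AE_I'[of "{h. \<exists>\<^sub>\<infinity>n. pos [] h n = g}"])
        (auto simp: io_prob_def null_sets_def S.emeasure_eq_measure)
    then show ?thesis
      by (simp add: frequently_cofinite)
  qed
  then have "AE h in S. \<forall>g. alternating g \<longrightarrow> finite {n. pos [] h n = g}"
    unfolding AE_all_countable by auto
  with AE_streams show ?thesis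
  proof eventually_elim
    case (elim h)
    have "finite {n. pos [] h n = g}" if "\<not> alternating g" for g
      using pos_alternating[OF elim(1), of "[]"] that by (metis (mono_tags, lifting) empty_Collect_eq finite.emptyI successively.simps(1))
    then show ?case
      using elim by (auto simp: transient_path_def)
  qed
qed

text \<open>Induction over the semigroup generated by the support: a single step is made at time 1
  with positive probability, and a product \<open>u \<odot> v\<close> is reached by way of
  \<open>u\<close>, using the strong Markov property and translation.\<close>

lemma hit_prob_pos: "alternating g \<Longrightarrow> 0 < hit_prob g []"
proof -
  have sub: "semigroup_gen (set_pmf \<mu>) \<subseteq> Collect alternating"
    using nondegenerate by (auto simp: nondegenerate_def)
  have "0 < hit_prob g []" if "g \<in> semigroup_gen (set_pmf \<mu>)" for g
    using that
  proof induction
    case (base s)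
    have "measure S {h. pos [] h 1 = s} = measure_pmf.expectation \<mu> (\<lambda>t. measure S {h. pos [] (t ## h) 1 = s})"
      by (intro measure_one_step) simp
    also have "\<dots> = measure_pmf.expectation \<mu> (\<lambda>t. indicator {s} t)"
    proof (intro integral_cong_AE AE_pmfI)
      fix t assume "t \<in> set_pmf \<mu>"
      then have "t \<in> steps" using support by blast
      then show "measure S {h. pos [] (t ## h) 1 = s} = indicator {s} t"
        using S.prob_space by (auto simp: indicator_def)
    qed auto
    also have "\<dots> = pmf \<mu> s"
      by (simp add: measure_pmf_single)
    finally have "0 < measure S {h. pos [] h 1 = s}"
      using base by (simp add: pmf_positive)
    also have "\<dots> \<le> hit_prob s []"
    proof -
      have "{h \<in> space S. \<exists>n. pos [] h n = s} \<in> sets S" by measurable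
      then show ?thesis
        unfolding hit_prob_def by (intro S.finite_measure_mono) (auto intro: exI[of _ "Suc 0"])
    qed
    finally show ?case .
  next
    case (mult u v)
    have alt: "alternating u" "alternating v" "alternating (u \<odot> v)"
      using mult.hyps sub by (auto intro: foldr_red_cons_alternating)
    have "hit_prob (u \<odot> v) u = hit_prob v []"
      using hit_prob_translate[of u v "[]"] alt by (simp add: foldr_red_cons_self)
    then have "0 < hit_prob u [] * hit_prob (u \<odot> v) u"
      using mult.IH by simp
    also have "\<dots> = measure S {h. \<exists>n. first_hit u [] n h \<and> (\<exists>m. pos u (sdrop n h) m = u \<odot> v)}"
      unfolding hit_prob_def[of "u \<odot> v"] by (rule strong_Markov[symmetric]) measurable
    also have "\<dots> \<le> hit_prob (u \<odot> v) []"
    proof -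
      have "{h \<in> space S. \<exists>n. pos [] h n = u \<odot> v} \<in> sets S" by measurable
      then show ?thesis
        unfolding hit_prob_def
        by (intro S.finite_measure_mono) (auto simp: first_hit_iff simp flip: pos_add)
    qed
    finally show ?case by simp
  qed
  moreover assume "alternating g"
  ultimately show ?thesis
    using nondegenerate unfolding nondegenerate_def by simp
qed

end

section \<open>The law of the limit word\<close>

abbreviation "letter_streams \<equiv> stream_space (count_space (UNIV :: letter set))"

text \<open>Chosen letter by letter, so that measurability can be checked in each coordinate. Only
  the values on converging paths matter.\<close>

definition limit_word :: "letter list stream \<Rightarrow> letter stream" where
  "limit_word h = to_stream (\<lambda>i. THE c. \<forall>\<^sub>F n in sequentially. i < length (pos [] h n) \<and> pos [] h n ! i = c)"

lemma limit_word_eq: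
  assumes "converges_to (pos [] h) \<xi>"
  shows "limit_word h = \<xi>"
proof -
  have "(THE c. \<forall>\<^sub>F n in sequentially. i < length (pos [] h n) \<and> pos [] h n ! i = c) = \<xi> !! i" for i
  proof (rule the_equality)
    show *: "\<forall>\<^sub>F n in sequentially. i < length (pos [] h n) \<and> pos [] h n ! i = \<xi> !! i"
      using converges_to_nth[OF assms] .
    fix c assume "\<forall>\<^sub>F n in sequentially. i < length (pos [] h n) \<and> pos [] h n ! i = c"
    with * have "\<forall>\<^sub>F n in sequentially. c = \<xi> !! i"
      by eventually_elim auto
    then show "c = \<xi> !! i" by simp
  qed
  then show ?thesis
    unfolding limit_word_def by (simp add: to_stream_def smap_alt)
qed

lemma limit_word_transient:
  assumes "transient_path h"
  shows "converges_to (pos [] h) (limit_word h)" "limit_word h \<in> boundary"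
  using transient_path_converges[OF assms] limit_word_eq by metis+

text \<open>From time \<open>n\<close> on the path is \<open>x\<close> times the path of the shifted
  increments, and left multiplication passes to the limit.\<close>

lemma limit_word_after_hit:
  assumes "transient_path h" "pos [] h n = x" "alternating x"
  shows "limit_word h = act x (limit_word (sdrop n h))"
proof -
  let ?h = "sdrop n h"
  have "pos [] h (m + n) = x \<odot> pos [] ?h m" for m
    using pos_gmul[of ?h "[]" x m] transient_path_sdrop[OF assms(1), of n] assms(2,3)
    by (simp add: transient_path_def foldr_red_cons_self add.commute[of m] pos_add)
  then have "converges_to (\<lambda>m. pos [] h (m + n)) (act x (limit_word ?h))"
    using converges_to_gmul limit_word_transient(1) transient_path_sdrop[OF assms(1)] by simp
  then show ?thesis
    using limit_word_eq by (simp add: converges_to_shift)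
qed

context nondegenerate_walk
begin

lemma measurable_limit_word [measurable]: "limit_word \<in> measurable S letter_streams"
proof (rule measurable_stream_space2)
  fix i
  have "(\<lambda>h. THE c. \<forall>\<^sub>F n in sequentially. i < length (pos [] h n) \<and> pos [] h n ! i = c)
      \<in> measurable S (count_space UNIV)"
  proof (rule measurable_THE)
    show "Measurable.pred S (\<lambda>h. \<forall>\<^sub>F n in sequentially. i < length (pos [] h n) \<and> pos [] h n ! i = c)" for c
      unfolding eventually_sequentially by measurable
    fix h c d
    assume "\<forall>\<^sub>F n in sequentially. i < length (pos [] h n) \<and> pos [] h n ! i = c"
      "\<forall>\<^sub>F n in sequentially. i < length (pos [] h n) \<and> pos [] h n ! i = d"
    then have "\<forall>\<^sub>F n in sequentially. c = d"
      by eventually_elim auto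
    then show "c = d" by simp
  qed (auto intro: countable_subset[OF subset_UNIV])
  then show "(\<lambda>h. limit_word h !! i) \<in> measurable S (count_space UNIV)"
    by (simp add: limit_word_def to_stream_def)
qed

lemma AE_limit_word: "AE h in S. converges_to (pos [] h) (limit_word h) \<and> limit_word h \<in> boundary"
  using AE_transient_path by eventually_elim (simp add: limit_word_transient)

text \<open>Almost surely the limit lies in the cone of \<open>x\<close> exactly if the path hits
  \<open>x\<close> and the limit of the increments after the first hit does not begin with
  \<open>a\<close>. The strong Markov property separates these two conditions.\<close>

lemma measure_limit_through_gate:
  assumes x: "x \<in> gates" and [measurable]: "Measurable.pred letter_streams E"
  shows "measure S {h. stake (length x) (limit_word h) = x \<and> E (limit_word h)} =
    hit_prob x [] * measure S {h. shd (limit_word h) \<noteq> La \<and> E (x @- limit_word h)}"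
proof -
  define A where "A h \<longleftrightarrow> shd (limit_word h) \<noteq> La \<and> E (x @- limit_word h)" for h
  have [measurable]: "(\<lambda>h. x @- limit_word h) \<in> measurable S letter_streams"
    by (induction x) simp_all
  have [measurable]: "Measurable.pred S A"
    unfolding A_def[abs_def] by measurable
  have "AE h in S. (stake (length x) (limit_word h) = x \<and> E (limit_word h)) \<longleftrightarrow>
      (\<exists>n. first_hit x [] n h \<and> A (sdrop n h))"
    using AE_transient_path
  proof eventually_elim
    case (elim h)
    have *: "stake (length x) (limit_word h) = x \<and> E (limit_word h) \<longleftrightarrow> A (sdrop n h)"
      if "first_hit x [] n h" for n
    proof -
      have "limit_word h = act x (limit_word (sdrop n h))"
        using limit_word_after_hit[OF elim, of n x] that gates_alternating[OF x] by (simp add: first_hit_iff)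
      moreover have "limit_word (sdrop n h) \<in> boundary"
        using limit_word_transient(2) transient_path_sdrop[OF elim] by blast
      ultimately show ?thesis
        using act_gate[OF x] unfolding A_def by auto
    qed
    have "\<exists>n. first_hit x [] n h" if "stake (length x) (limit_word h) = x"
      using hits_gate[OF _ limit_word_transient(1)[OF elim] x that] elim
      by (simp add: ex_first_hit transient_path_def)
    with * show ?case by blast
  qed
  then have "measure S {h. stake (length x) (limit_word h) = x \<and> E (limit_word h)} =
      measure S {h. \<exists>n. first_hit x [] n h \<and> A (sdrop n h)}"
    by (rule prob_eq_AE) measurable
  then show ?thesis
    using strong_Markov[of A x "[]"] by (simp add: A_def)
qed

text \<open>Cylinder masses of the limit law are split by whether the first letter is
  \<open>a\<close>, because the gate relations express each half through the other.\<close>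

definition lim_a :: "letter list \<Rightarrow> real" where
  "lim_a v = measure S {h. shd (limit_word h) = La \<and> limit_word h \<in> sstart UNIV v}"

definition lim_b :: "letter list \<Rightarrow> real" where
  "lim_b v = measure S {h. shd (limit_word h) \<noteq> La \<and> limit_word h \<in> sstart UNIV v}"

lemma lim_a_eq: 
  "lim_a v = hit_prob [La] [] * measure S {h. shd (limit_word h) \<noteq> La \<and> La ## limit_word h \<in> sstart UNIV v}"
  using measure_limit_through_gate[of "[La]" "\<lambda>\<xi>. \<xi> \<in> sstart UNIV v"] by (simp add: lim_a_def)

lemma lim_a_Nil: "lim_a [] = hit_prob [La] [] * lim_b []"
  by (simp add: lim_a_eq lim_b_def)

lemma lim_a_Cons: "lim_a (c # v) = (if c = La then hit_prob [La] [] * lim_b v else 0)"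
  by (auto simp: lim_a_eq lim_b_def)

lemma lim_b_Cons_La: "lim_b (La # v) = 0"
proof -
  have "{h. shd (limit_word h) \<noteq> La \<and> limit_word h \<in> sstart UNIV (La # v)} = {}"
    by auto
  then show ?thesis
    unfolding lim_b_def by (metis measure_empty)
qed

text \<open>Boundary words beginning with \<open>c\<close> continue with \<open>a\<close>, so the
  gate \<open>ca\<close> carries the whole cylinder. The remaining event is the one in
  \<open>lim_a_eq\<close> for \<open>v\<close>; the factor on the left clears the
  denominator.\<close>

lemma lim_b_Cons:
  assumes "c \<noteq> La"
  shows "lim_b (c # v) * hit_prob [La] [] = hit_prob [c, La] [] * lim_a v"
proof -
  have "AE h in S. (shd (limit_word h) \<noteq> La \<and> limit_word h \<in> sstart UNIV (c # v)) \<longleftrightarrow>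
      (stake (length [c, La]) (limit_word h) = [c, La] \<and> limit_word h \<in> sstart UNIV (c # v))"
    using AE_limit_word
  proof eventually_elim
    case (elim h)
    have "alternates (limit_word h !! 0) (limit_word h !! Suc 0)"
      using elim unfolding boundary_def by blast
    then show ?case
      using assms by (auto simp: alternates_def)
  qed
  then have "lim_b (c # v) = 
      measure S {h. stake (length [c, La]) (limit_word h) = [c, La] \<and> limit_word h \<in> sstart UNIV (c # v)}"
    unfolding lim_b_def by (rule prob_eq_AE) measurable
  also have "\<dots> = hit_prob [c, La] [] *
      measure S {h. shd (limit_word h) \<noteq> La \<and> [c, La] @- limit_word h \<in> sstart UNIV (c # v)}"
    using assms by (intro measure_limit_through_gate) (cases c, auto)
  finally show ?thesis
    by (simp add: lim_a_eq)
qed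

lemma lim_a_plus_lim_b: "measure S {h. limit_word h \<in> sstart UNIV v} = lim_a v + lim_b v"
proof -
  have "{h \<in> space S. shd (limit_word h) = La \<and> limit_word h \<in> sstart UNIV v} \<in> sets S"
    "{h \<in> space S. shd (limit_word h) \<noteq> La \<and> limit_word h \<in> sstart UNIV v} \<in> sets S"
    by measurable
  then show ?thesis
    unfolding lim_a_def lim_b_def by (subst S.finite_measure_Union[symmetric]) (auto intro!: arg_cong[where f = "measure S"])
qed

lemma hit_prob_La_pos: "0 < hit_prob [La] []"
  by (rule hit_prob_pos) simp

lemma lim_b_Nil: "lim_b [] = 1 / (1 + hit_prob [La] [])"
proof -
  have "hit_prob [La] [] * lim_b [] + lim_b [] = 1"
    using lim_a_plus_lim_b[of "[]"] S.prob_space lim_a_Nil by simp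
  then show ?thesis
    using hit_prob_La_pos by (simp add: field_simps)
qed

lemma lim_b_singleton: "c \<noteq> La \<Longrightarrow> lim_b [c] = hit_prob [c, La] [] * lim_b []"
  using lim_b_Cons[of c "[]"] hit_prob_La_pos by (simp add: lim_a_Nil)

text \<open>A word not beginning with \<open>a\<close> begins with \<open>b\<close> or
  \<open>b^-1\<close>, so the two masses \<open>lim_b [c]\<close> add up to \<open>lim_b []\<close>,
  which is positive and cancels.\<close>

lemma hit_prob_gates_sum: "hit_prob [Lb, La] [] + hit_prob [Lbbar, La] [] = 1"
proof -
  have "{h \<in> space S. shd (limit_word h) \<noteq> La \<and> limit_word h \<in> sstart UNIV [c]} \<in> sets S" for c
    by measurable
  then have "lim_b [Lb] + lim_b [Lbbar] = measure S 
      ({h. shd (limit_word h) \<noteq> La \<and> limit_word h \<in> sstart UNIV [Lb]} \<union> 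
       {h. shd (limit_word h) \<noteq> La \<and> limit_word h \<in> sstart UNIV [Lbbar]})"
    unfolding lim_b_def by (subst S.finite_measure_Union) auto
  also have "\<dots> = lim_b []"
    unfolding lim_b_def by (intro arg_cong[where f = "measure S"]) (auto intro: letter.exhaust)
  finally show ?thesis
    using lim_b_Nil hit_prob_La_pos by (simp add: lim_b_singleton flip: add_divide_distrib)
qed

end

section \<open>The Denjoy measures\<close>

abbreviation "b_letter e \<equiv> if e then Lb else Lbbar"

abbreviation "bool_streams \<alpha> \<equiv> stream_space (measure_pmf (bernoulli_pmf \<alpha>))"

lemma space_bool_streams [simp]: "space (bool_streams \<alpha>) = UNIV"
  by (simp add: space_stream_space)

lemma prob_space_bool_streams: "prob_space (bool_streams \<alpha>)"
  by (rule prob_space.prob_space_stream_space) (rule prob_space_measure_pmf)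

lemma sets_bool_streams [measurable_cong]: "sets (bool_streams \<alpha>) = sets (stream_space (count_space UNIV))"
  by (intro sets_stream_space_cong) simp

lemma denjoy_word_simps:
  "shd (denjoy_word \<epsilon>) = La"
  "shd (stl (denjoy_word \<epsilon>)) = b_letter (shd \<epsilon>)"
  "stl (stl (denjoy_word \<epsilon>)) = denjoy_word (stl \<epsilon>)"
  by (simp_all add: denjoy_word_def)

section \<open>Measurability of the boundary and of the Denjoy words\<close>

lemma boundary_measurable [measurable]: "boundary \<in> sets letter_streams"
proof -
  have "{\<xi> \<in> space letter_streams. \<forall>n. alternates (\<xi> !! n) (\<xi> !! Suc n)} \<in> sets letter_streams"
    by measurable
  then show ?thesis
    by (simp add: boundary_def space_stream_space)
qed

lemma space_bdry: "space bdry = boundary"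
  by (simp add: bdry_def space_restrict_space space_stream_space)

lemma sets_bdry: "E \<in> sets bdry \<longleftrightarrow> E \<in> sets letter_streams \<and> E \<subseteq> boundary"
  unfolding bdry_def by (subst sets_restrict_space_iff) (auto simp: space_stream_space)

lemma measurable_bdry_into: "f \<in> measurable M letter_streams \<Longrightarrow> (\<And>x. f x \<in> boundary) \<Longrightarrow> f \<in> measurable M bdry"
  unfolding bdry_def by (intro measurable_restrict_space2) auto

lemma measurable_bdry_id: "(\<lambda>x. x) \<in> measurable bdry letter_streams"
  unfolding bdry_def by (intro measurable_restrict_space1) simp

lemma denjoy_word_snth: "denjoy_word \<epsilon> !! n = (if even n then La else b_letter (\<epsilon> !! (n div 2)))"
proof (induction n arbitrary: \<epsilon> rule: induct_nat_012)
  case (ge2 n)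
  have "denjoy_word \<epsilon> !! Suc (Suc n) = denjoy_word (stl \<epsilon>) !! n"
    by (simp add: denjoy_word_simps)
  also have "\<dots> = (if even n then La else b_letter (\<epsilon> !! Suc (n div 2)))"
    by (simp add: ge2(1))
  finally show ?case by simp
qed (simp_all add: denjoy_word_simps)

lemma measurable_denjoy_word [measurable]: "denjoy_word \<in> measurable (bool_streams \<alpha>) letter_streams"
proof (rule measurable_stream_space2)
  fix n
  have "(\<lambda>\<epsilon>. b_letter (\<epsilon> !! (n div 2))) \<in> measurable (bool_streams \<alpha>) (count_space UNIV)"
    by (rule measurable_compose[OF measurable_snth]) simp
  then show "(\<lambda>\<epsilon>. denjoy_word \<epsilon> !! n) \<in> measurable (bool_streams \<alpha>) (count_space UNIV)"
    unfolding denjoy_word_snth by (cases "even n") simp_all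
qed

lemma denjoy_word_boundary: "denjoy_word \<epsilon> \<in> boundary"
  by (auto simp: boundary_def alternates_def denjoy_word_snth simp del: snth.simps)

lemma measurable_denjoy_word_bdry: "denjoy_word \<in> measurable (bool_streams \<alpha>) bdry"
  by (intro measurable_bdry_into measurable_denjoy_word denjoy_word_boundary)

lemma act_La_measurable: "act [La] \<in> measurable bdry bdry"
proof -
  have "act [La] \<xi> = (if shd \<xi> = La then stl \<xi> else La ## \<xi>)" for \<xi>
    by (cases \<xi>; cases "shd \<xi>") (auto simp: act_def red_scons_def)
  then have "act [La] = (\<lambda>\<xi>. if shd \<xi> = La then stl \<xi> else La ## \<xi>)"
    by blast
  moreover have "(\<lambda>\<xi>. if shd \<xi> = La then stl \<xi> else La ## \<xi>) \<in> measurable letter_streams letter_streams"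
    by measurable
  ultimately have "act [La] \<in> measurable bdry letter_streams"
    unfolding bdry_def by (simp add: measurable_restrict_space1)
  then show ?thesis
    unfolding bdry_def by (intro measurable_restrict_space2) (auto simp: space_restrict_space intro: act_boundary)
qed

section \<open>Masses and null sets of the Denjoy measures\<close>

lemma sets_kappa: "sets (kappa \<alpha>) = sets bdry"
  by (simp add: kappa_def)

lemma emeasure_kappa:
  "E \<in> sets bdry \<Longrightarrow> emeasure (kappa \<alpha>) E = emeasure (bool_streams \<alpha>) {\<epsilon>. denjoy_word \<epsilon> \<in> E}"
  unfolding kappa_def
  by (subst emeasure_distr[OF measurable_denjoy_word_bdry]) (auto simp: vimage_def)

lemma emeasure_act_kappa:
  assumes "E \<in> sets bdry"
  shows "emeasure (distr (kappa \<alpha>) bdry (act [La])) E = emeasure (bool_streams \<alpha>) {\<epsilon>. stl (denjoy_word \<epsilon>) \<in> E}"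
proof -
  \<comment> \<open>Denjoy words begin with \<open>a\<close>, so acting by \<open>a\<close> deletes
    this letter.\<close>
  have act: "act [La] (denjoy_word \<epsilon>) = stl (denjoy_word \<epsilon>)" for \<epsilon>
    by (simp add: act_def red_scons_def denjoy_word_simps)
  have meas: "act [La] \<in> measurable (kappa \<alpha>) bdry"
    using act_La_measurable by (simp add: kappa_def)
  have sp: "space (kappa \<alpha>) = space bdry"
    by (simp add: kappa_def)
  have "emeasure (distr (kappa \<alpha>) bdry (act [La])) E = emeasure (kappa \<alpha>) (act [La] -` E \<inter> space bdry)"
    using assms emeasure_distr[OF meas] sp by simp
  also have "\<dots> = emeasure (bool_streams \<alpha>) {\<epsilon>. denjoy_word \<epsilon> \<in> act [La] -` E \<inter> space bdry}"
    using measurable_sets[OF act_La_measurable assms] by (rule emeasure_kappa)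
  finally show ?thesis
    using denjoy_word_boundary by (simp add: act space_bdry)
qed

text \<open>\<open>measure_of\<close> takes the prescribed values once the set function is known to
  be positive and countably additive; both are inherited from the two summands.\<close>

lemma emeasure_kappa2:
  assumes "E \<in> sets bdry"
  shows "emeasure (kappa2 \<alpha> p) E = 
    ennreal p * emeasure (kappa \<alpha>) E + ennreal (1 - p) * emeasure (distr (kappa \<alpha>) bdry (act [La])) E"
proof (rule emeasure_measure_of[OF kappa2_def])
  let ?f = "\<lambda>E. ennreal p * emeasure (kappa \<alpha>) E + ennreal (1 - p) * emeasure (distr (kappa \<alpha>) bdry (act [La])) E"
  have [simp]: "sets (kappa2 \<alpha> p) = sets bdry"
    by (simp add: kappa2_def sets.sigma_sets_eq sets.space_closed)
  show "countably_additive (sets (kappa2 \<alpha> p)) ?f"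
  proof (rule countably_additiveI)
    fix A :: "nat \<Rightarrow> letter stream set"
    assume A: "range A \<subseteq> sets (kappa2 \<alpha> p)" "disjoint_family A"
    have "(\<Sum>i. ?f (A i)) = ennreal p * (\<Sum>i. emeasure (kappa \<alpha>) (A i)) 
        + ennreal (1 - p) * (\<Sum>i. emeasure (distr (kappa \<alpha>) bdry (act [La])) (A i))"
      by (simp add: suminf_add[symmetric] ennreal_suminf_cmult)
    also have "\<dots> = ?f (\<Union>i. A i)"
      using A by (simp add: suminf_emeasure sets_kappa)
    finally show "(\<Sum>i. ?f (A i)) = ?f (\<Union>i. A i)" .
  qed
  show "positive (sets (kappa2 \<alpha> p)) ?f"
    by (simp add: positive_def)
  show "E \<in> sets (kappa2 \<alpha> p)" "sets bdry \<subseteq> Pow (space bdry)"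
    using assms sets.space_closed by auto
qed

lemma sets_kappa2 [simp]: "sets (kappa2 \<alpha> p) = sets bdry"
  by (simp add: kappa2_def sets.sigma_sets_eq sets.space_closed)

lemma space_kappa2 [simp]: "space (kappa2 \<alpha> p) = boundary"
  using sets_eq_imp_space_eq[OF sets_kappa2] by (simp add: space_bdry)

lemma measurable_kappa2_id: "(\<lambda>x. x) \<in> measurable (kappa2 \<alpha> p) letter_streams"
  using measurable_bdry_id measurable_cong_sets[OF sets_kappa2 refl] by blast

lemma emeasure_kappa2':
  assumes "E \<in> sets bdry"
  shows "emeasure (kappa2 \<alpha> p) E = ennreal p * emeasure (bool_streams \<alpha>) {\<epsilon>. denjoy_word \<epsilon> \<in> E}
    + ennreal (1 - p) * emeasure (bool_streams \<alpha>) {\<epsilon>. stl (denjoy_word \<epsilon>) \<in> E}"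
  using assms by (simp add: emeasure_kappa2 emeasure_kappa emeasure_act_kappa)

lemma prob_space_kappa2:
  assumes "0 \<le> p" "p \<le> 1"
  shows "prob_space (kappa2 \<alpha> p)"
proof
  interpret B: prob_space "bool_streams \<alpha>"
    by (rule prob_space_bool_streams)
  have "emeasure (kappa2 \<alpha> p) boundary = ennreal p + ennreal (1 - p)"
    using B.emeasure_space_1 denjoy_word_boundary boundary_stl[OF denjoy_word_boundary]
    by (subst emeasure_kappa2') (simp_all add: sets_bdry)
  also have "\<dots> = 1"
    using assms by (simp flip: ennreal_plus)
  finally show "emeasure (kappa2 \<alpha> p) (space (kappa2 \<alpha> p)) = 1"
    by simp
qed

text \<open>With positive weights a set is null exactly if it is null for both summands, a condition
  free of the weight.\<close>

lemma null_sets_kappa2: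
  assumes "0 < p" "p < 1" "0 < q" "q < 1"
  shows "null_sets (kappa2 \<alpha> p) = null_sets (kappa2 \<alpha> q)"
  using assms by (auto simp: null_sets_def emeasure_kappa2)

lemma kappa2_denjoy_class:
  assumes "0 < p" "p < 1"
  shows "kappa2 \<alpha> p \<in> denjoy_class \<alpha>"
proof -
  interpret prob_space "kappa2 \<alpha> p"
    using assms by (intro prob_space_kappa2) auto
  show ?thesis
    using null_sets_kappa2[OF assms] by (auto simp: denjoy_class_def measure_class_def intro: sigma_finite_measure_axioms)
qed

text \<open>\<open>word_a\<close> and \<open>word_b\<close> are the cylinder masses of \<kappa> and
  of its image under \<open>a\<close>; up to the weights \<open>p\<close> and \<open>1 - p\<close>
  they are the counterparts of \<open>lim_a\<close> and \<open>lim_b\<close>.\<close>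

definition word_a :: "real \<Rightarrow> letter list \<Rightarrow> real" where
  "word_a \<alpha> v = measure (bool_streams \<alpha>) {\<epsilon>. denjoy_word \<epsilon> \<in> sstart UNIV v}"

definition word_b :: "real \<Rightarrow> letter list \<Rightarrow> real" where
  "word_b \<alpha> v = measure (bool_streams \<alpha>) {\<epsilon>. stl (denjoy_word \<epsilon>) \<in> sstart UNIV v}"

lemma word_Nil: "word_a \<alpha> [] = 1" "word_b \<alpha> [] = 1"
  using prob_space.prob_space[OF prob_space_bool_streams[of \<alpha>]] by (simp_all add: word_a_def word_b_def)

lemma word_a_Cons: "word_a \<alpha> (c # v) = (if c = La then word_b \<alpha> v else 0)"
  by (auto simp: word_a_def word_b_def denjoy_word_simps)

text \<open>The first coin decides between \<open>b\<close> and \<open>b^-1\<close>; what follows is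
  again a Denjoy word, independent of it.\<close>

lemma word_b_Cons:
  assumes "0 \<le> \<alpha>" "\<alpha> \<le> 1"
  shows "word_b \<alpha> (c # v) = (case c of La \<Rightarrow> 0 | Lb \<Rightarrow> \<alpha> * word_a \<alpha> v | Lbbar \<Rightarrow> (1 - \<alpha>) * word_a \<alpha> v)"
proof -
  interpret B: prob_space "bool_streams \<alpha>"
    by (rule prob_space_bool_streams)
  have "{\<epsilon> \<in> space (bool_streams \<alpha>). stl (denjoy_word \<epsilon>) \<in> sstart UNIV (c # v)} \<in> sets (bool_streams \<alpha>)"
    by measurable
  then have "ennreal (word_b \<alpha> (c # v)) = (\<integral>\<^sup>+e. emeasure (bool_streams \<alpha>) 
      {\<epsilon>. stl (denjoy_word (e ## \<epsilon>)) \<in> sstart UNIV (c # v)} \<partial>bernoulli_pmf \<alpha>)"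
    using prob_space.emeasure_stream_space[OF prob_space_measure_pmf, 
      of "{\<epsilon>. stl (denjoy_word \<epsilon>) \<in> sstart UNIV (c # v)}" "bernoulli_pmf \<alpha>"]
    by (simp add: word_b_def B.emeasure_eq_measure)
  also have "\<dots> = (\<integral>\<^sup>+e. ennreal (indicator {c} (b_letter e) * word_a \<alpha> v) \<partial>bernoulli_pmf \<alpha>)"
    by (intro nn_integral_cong) (auto simp: denjoy_word_simps word_a_def B.emeasure_eq_measure indicator_def)
  also have "\<dots> = ennreal (indicator {c} Lb * word_a \<alpha> v) * ennreal \<alpha>
      + ennreal (indicator {c} Lbbar * word_a \<alpha> v) * ennreal (1 - \<alpha>)"
    using assms by (subst nn_integral_bernoulli_pmf) auto
  also have "\<dots> = ennreal (indicator {c} Lb * word_a \<alpha> v * \<alpha> + indicator {c} Lbbar * word_a \<alpha> v * (1 - \<alpha>))"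
    using assms by (subst ennreal_plus) (auto simp: word_a_def ennreal_mult)
  finally show ?thesis
    using assms by (subst (asm) ennreal_inj) (auto simp: word_a_def word_b_def split: letter.split)
qed

section \<open>Identification of the harmonic measure\<close>

context nondegenerate_walk
begin

text \<open>By induction on \<open>v\<close>: the weighted Denjoy masses satisfy the recursion that
  the gates impose on \<open>lim_a\<close> and \<open>lim_b\<close>.\<close>

lemma lim_eq_word:
  defines "p \<equiv> hit_prob [La] [] / (1 + hit_prob [La] [])" and "\<alpha> \<equiv> hit_prob [Lb, La] []"
  shows "lim_a v = p * word_a \<alpha> v \<and> lim_b v = (1 - p) * word_b \<alpha> v"
proof (induction v)
  case Nil
  show ?case
    using hit_prob_La_pos by (simp add: lim_a_Nil lim_b_Nil word_Nil p_def field_simps)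
next
  case (Cons c v)
  \<comment> \<open>This identity determines \<open>p\<close>: passing the gate \<open>a\<close>
    turns the weight \<open>1 - p\<close> into \<open>p\<close>.\<close>
  have p: "hit_prob [La] [] * (1 - p) = p"
    using hit_prob_La_pos by (simp add: p_def field_simps)
  have \<alpha>: "0 \<le> \<alpha>" "\<alpha> \<le> 1" "hit_prob [Lbbar, La] [] = 1 - \<alpha>"
    using hit_prob_gates_sum by (auto simp: \<alpha>_def hit_prob_def)
  have "lim_a (c # v) = p * word_a \<alpha> (c # v)"
    using Cons p by (simp add: lim_a_Cons word_a_Cons flip: mult.assoc)
  moreover have "lim_b (c # v) = (1 - p) * word_b \<alpha> (c # v)"
  proof (cases "c = La")
    case False
    have "lim_b (c # v) * hit_prob [La] [] = hit_prob [c, La] [] * (hit_prob [La] [] * (1 - p) * word_a \<alpha> v)"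
      using Cons p lim_b_Cons[OF False] by simp
    then have "lim_b (c # v) = (1 - p) * (hit_prob [c, La] [] * word_a \<alpha> v)"
      using hit_prob_La_pos by simp
    then show ?thesis
      using False \<alpha> by (cases c) (simp_all add: word_b_Cons \<alpha>_def)
  qed (simp add: lim_b_Cons_La word_b_Cons \<alpha>)
  ultimately show ?case ..
qed

lemma passage_prob_eq: "passage_prob \<mu> g = hit_prob g []"
  by (simp add: passage_prob_def increments_def hit_prob_def walk_eq_pos)

text \<open>Cylinder masses determine a probability measure on all letter streams; the Denjoy
  measure is therefore first carried there by inclusion.\<close>

lemma distr_limit_word:
  defines "p \<equiv> hit_prob [La] [] / (1 + hit_prob [La] [])" and "\<alpha> \<equiv> hit_prob [Lb, La] []"
  shows "distr S letter_streams limit_word = distr (kappa2 \<alpha> p) letter_streams (\<lambda>x. x)"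
proof (rule stream_space_eq_sstart[of UNIV])
  have p: "0 \<le> p" "p \<le> 1"
    using hit_prob_La_pos by (simp_all add: p_def)
  interpret K: prob_space "kappa2 \<alpha> p"
    using p by (rule prob_space_kappa2)
  interpret B: prob_space "bool_streams \<alpha>"
    by (rule prob_space_bool_streams)
  show "prob_space (distr S letter_streams limit_word)"
    by (rule S.prob_space_distr) measurable
  show "prob_space (distr (kappa2 \<alpha> p) letter_streams (\<lambda>x. x))"
    by (rule K.prob_space_distr[OF measurable_kappa2_id])
  fix v :: "letter list"
  have "emeasure (distr S letter_streams limit_word) (sstart UNIV v) = ennreal (p * word_a \<alpha> v + (1 - p) * word_b \<alpha> v)"
    using lim_eq_word lim_a_plus_lim_b[of v]
    by (simp add: emeasure_distr sets_sstart vimage_def S.emeasure_eq_measure p_def \<alpha>_def)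
  also have "\<dots> = emeasure (kappa2 \<alpha> p) (sstart UNIV v \<inter> boundary)"
    using denjoy_word_boundary boundary_stl[OF denjoy_word_boundary] p
    by (subst emeasure_kappa2') 
       (simp_all add: sets_bdry word_a_def word_b_def B.emeasure_eq_measure sets_sstart flip: ennreal_mult ennreal_plus)
  also have "\<dots> = emeasure (distr (kappa2 \<alpha> p) letter_streams (\<lambda>x. x)) (sstart UNIV v)"
    using measurable_kappa2_id by (simp add: emeasure_distr sets_sstart vimage_def)
  finally show "emeasure (distr S letter_streams limit_word) (sstart UNIV v) = 
      emeasure (distr (kappa2 \<alpha> p) letter_streams (\<lambda>x. x)) (sstart UNIV v)" .
qed (auto intro: countable_subset[OF subset_UNIV])

text \<open>Limits are unique, so only \<open>limit_word h\<close> can witness the existential;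
  convergence holds almost surely and drops out.\<close>

lemma emeasure_limit_in:
  assumes "E \<in> sets bdry"
  shows "emeasure (increments \<mu>) {h \<in> space (increments \<mu>). \<exists>\<xi>\<in>E. converges_to (walk h) \<xi>} =
    emeasure (distr S letter_streams limit_word) E"
proof -
  have [measurable]: "E \<in> sets letter_streams"
    using assms by (simp add: sets_bdry)
  have eq: "(\<exists>\<xi>\<in>E. converges_to (walk h) \<xi>) \<longleftrightarrow> converges_to (pos [] h) (limit_word h) \<and> limit_word h \<in> E" for h
    using limit_word_eq by (auto simp: walk_eq_pos)
  have [measurable]: "Measurable.pred S (\<lambda>h. converges_to (pos [] h) (limit_word h))"
    unfolding converges_to_iff_nth eventually_sequentially by measurable
  have "emeasure S {h \<in> space S. converges_to (pos [] h) (limit_word h) \<and> limit_word h \<in> E} = 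
      emeasure S {h \<in> space S. limit_word h \<in> E}"
  proof (rule emeasure_eq_AE)
    show "AE h in S. h \<in> {h \<in> space S. converges_to (pos [] h) (limit_word h) \<and> limit_word h \<in> E} \<longleftrightarrow>
        h \<in> {h \<in> space S. limit_word h \<in> E}"
      using AE_limit_word by eventually_elim simp
  qed measurable
  then show ?thesis
    by (simp add: increments_def eq emeasure_distr vimage_def)
qed

lemma harmonic_measure_eq_kappa2:
  "harmonic_measure \<mu> = kappa2 (hit_prob [Lb, La] []) (hit_prob [La] [] / (1 + hit_prob [La] []))"
proof -
  define p where "p = hit_prob [La] [] / (1 + hit_prob [La] [])"
  define \<alpha> where "\<alpha> = hit_prob [Lb, La] []"
  have *: "emeasure (increments \<mu>) {h \<in> space (increments \<mu>). \<exists>\<xi>\<in>E. converges_to (walk h) \<xi>} =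
      ennreal p * emeasure (kappa \<alpha>) E + ennreal (1 - p) * emeasure (distr (kappa \<alpha>) bdry (act [La])) E"
    if "E \<in> sets bdry" for E
  proof -
    have E: "E \<in> sets letter_streams" "E \<inter> boundary = E"
      using that by (auto simp: sets_bdry)
    have "emeasure (increments \<mu>) {h \<in> space (increments \<mu>). \<exists>\<xi>\<in>E. converges_to (walk h) \<xi>} =
        emeasure (distr (kappa2 \<alpha> p) letter_streams (\<lambda>x. x)) E"
      using emeasure_limit_in[OF that] distr_limit_word by (simp add: p_def \<alpha>_def)
    also have "\<dots> = emeasure (kappa2 \<alpha> p) E"
      using measurable_kappa2_id E by (simp add: emeasure_distr vimage_def)
    finally show ?thesis
      using that by (simp add: emeasure_kappa2)
  qed
  \<comment> \<open>Both sides are \<open>measure_of\<close> over the same space and sigma-algebra,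
    so set functions agreeing there give equal measures.\<close>
  show ?thesis
    unfolding harmonic_measure_def kappa2_def p_def[symmetric] \<alpha>_def[symmetric]
    by (rule measure_of_eq) (simp_all add: sets.space_closed sets.sigma_sets_eq *)
qed

end

theorem theorem2p3:
  fixes \<mu> :: "letter list pmf"
  assumes "nondegenerate \<mu>"
    and "set_pmf \<mu> \<subseteq> {[La], [Lb], [Lbbar], [Lb, La], [Lbbar, La]}"
  shows "(\<exists>\<alpha>. 0 < \<alpha> \<and> \<alpha> < 1 \<and> harmonic_measure \<mu> \<in> denjoy_class \<alpha>) \<and>
    (let \<alpha> = passage_prob \<mu> [Lb, La];
         p = passage_prob \<mu> [La] / (1 + passage_prob \<mu> [La])
     in 0 < \<alpha> \<and> \<alpha> < 1 \<and> 0 < p \<and> p < 1 \<and> harmonic_measure \<mu> = kappa2 \<alpha> p)"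
proof -
  interpret nondegenerate_walk \<mu>
    using assms by unfold_locales
  have "0 < hit_prob [Lb, La] []" "0 < hit_prob [Lbbar, La] []"
    by (auto intro!: hit_prob_pos simp: alternates_def)
  \<comment> \<open>The complementary probability is the passage probability of
    \<open>b^-1 a\<close>, which is positive too.\<close>
  then have \<alpha>: "0 < hit_prob [Lb, La] []" "hit_prob [Lb, La] [] < 1"
    using hit_prob_gates_sum by auto
  have p: "0 < hit_prob [La] [] / (1 + hit_prob [La] [])" "hit_prob [La] [] / (1 + hit_prob [La] []) < 1"
    using hit_prob_La_pos by auto
  have "harmonic_measure \<mu> \<in> denjoy_class (hit_prob [Lb, La] [])"
    unfolding harmonic_measure_eq_kappa2 by (rule kappa2_denjoy_class[OF p])
  then show ?thesis
    using \<alpha> p harmonic_measure_eq_kappa2 by (auto simp: Let_def passage_prob_eq)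
qed

end
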